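(* Let $K_1$ and $K_2$ be closed cones in $\mathbb{R}^k$ and let an ultrafunctional $u\in\mathcal U(\mathbb{R}^k)$ be carried by $K_1\cup K_2$. Then there are $u_1,u_2\in\mathcal U(\mathbb{R}^k)$, carried by $K_1$ and $K_2$ respectively, such that $u=u_1+u_2$.
   Context: A cone in $\mathbb{R}^k$ is a nonempty subset invariant under multiplication by positive reals (all cones are assumed nonempty). $|x|=\max_j|x_j|$ on $\mathbb{R}^k$. A cone $W$ has open projection if its image in the sphere $(\mathbb{R}^k\setminus\{0\})/\mathbb{R}_+$ is open (so $\{0\}$ has open, empty, projection). $W$ is a conic neighborhood of a cone $U$ if $W$ has open projection and $U\subset W$. A cone $U$ is proper if $\bar U\setminus\{0\}$ is contained in an open half-space $\{x: l(x)>0\}$, $l$ a linear functional. Put $\delta_U(x)=\inf_{x'\in U}|x-x'|$. For a cone $U$ and $A,B>0$, $S^{0,B}_{1,A}(U)$ is the Banach space of entire functions $f$ on $\mathbb{C}^k$ with finite norm $\sup_{z=x+iy\in\mathbb{C}^k}|f(z)|\exp(|x/A|-\delta_U(Bx)-|By|)$, and $S^0_1(U)=\bigcup_{A,B>0,\,W\supset U}S^{0,B}_{1,A}(W)$, where $W$ runs over all conic neighborhoods of $U$, with the inductive limit topology. $S'^{0}_1(U)$ is its continuous dual. For closed cones $K'\subset K$ one has $S^0_1(K)\subset S^0_1(K')$ continuously, and $\rho_{K',K}\colon S'^{0}_1(K')\to S'^{0}_1(K)$ is restriction of functionals to $S^0_1(K)$. For a closed cone $M$, let $\mathcal P(M)$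 be the set of all nonempty proper closed cones contained in $M$, ordered by inclusion. Then $\mathcal U(M)=\varinjlim_{K\in\mathcal P(M)}S'^{0}_1(K)$ (a vector space), the inductive limit over the partially ordered, not necessarily directed, set $\mathcal P(M)$: the quotient of $\bigoplus_{K\in\mathcal P(M)}S'^{0}_1(K)$ by the subspace spanned by all $\iota_{K'}u-\iota_K\rho_{K',K}u$ with $K'\subset K$ in $\mathcal P(M)$, $u\in S'^{0}_1(K')$, $\iota_K$ denoting the canonical embedding of the summand. For closed cones $K'\subset K$, there is a canonical mapping $\mathcal U(K')\to\mathcal U(K)$ induced by the inclusion $\mathcal P(K')\subset\mathcal P(K)$. Elements of $\mathcal U(\mathbb{R}^k)$ are called ultrafunctionals. An ultrafunctional $u$ is carried by a closed cone $K$ if $u$ belongs to the image of the canonical mapping $\mathcal U(K)\to\mathcal U(\mathbb{R}^k)$. *)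

theory Defs
  imports "HOL-Analysis.Analysis" "HOL-Library.Function_Algebras" "HOL-Library.Set_Algebras"
begin

subsection \<open>Cones\<close>

text \<open>
  The library notions \<open>cone\<close> and \<open>conic\<close> allow the empty set and force \<open>0\<close> to be an
  element; neither is wanted here.
\<close>

definition pcone :: "(real^'k) set \<Rightarrow> bool" where
  "pcone U \<longleftrightarrow> U \<noteq> {} \<and> (\<forall>x\<in>U. \<forall>t>0. t *\<^sub>R x \<in> U)"

text \<open>
  The quotient of the punctured space by the positive reals is realised as the Euclidean unit
  sphere, the quotient map being \<open>sgn x = x / norm x\<close>.
\<close>

definition open_projection :: "(real^'k) set \<Rightarrow> bool" where
  "open_projection W \<longleftrightarrow> openin (top_of_set (sphere 0 1)) (sgn ` (W - {0}))"

definition conic_nbhd :: "(real^'k) set \<Rightarrow> (real^'k) set \<Rightarrow> bool" where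
  "conic_nbhd W U \<longleftrightarrow> pcone W \<and> open_projection W \<and> U \<subseteq> W"

definition proper_cone :: "(real^'k) set \<Rightarrow> bool" where
  "proper_cone U \<longleftrightarrow> pcone U \<and>
     (\<exists>l :: real^'k \<Rightarrow> real. linear l \<and> closure U - {0} \<subseteq> {x. l x > 0})"

text \<open>\<open>infnorm x\<close> is the maximum of the numbers \<open>\<bar>x $ j\<bar>\<close>.\<close>

definition cone_dist :: "(real^'k) set \<Rightarrow> real^'k \<Rightarrow> real" where
  "cone_dist U x = (INF x'\<in>U. infnorm (x - x'))"


subsection \<open>Test functions\<close>

type_synonym 'k testfun = "complex^'k \<Rightarrow> complex"

definition entire :: "'k::finite testfun \<Rightarrow> bool" where
  "entire f \<longleftrightarrow> (\<forall>z. \<exists>D. (f has_derivative D) (at z) \<and> (\<forall>c v. D (c *s v) = c * D v))"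

definition re_part :: "complex^'k \<Rightarrow> real^'k" where
  "re_part z = (\<chi> j. Re (z $ j))"

definition im_part :: "complex^'k \<Rightarrow> real^'k" where
  "im_part z = (\<chi> j. Im (z $ j))"

definition weighted :: "real \<Rightarrow> real \<Rightarrow> (real^'k) set \<Rightarrow> 'k::finite testfun \<Rightarrow> complex^'k \<Rightarrow> real" where
  "weighted A B U f z =
     norm (f z) * exp (infnorm ((1 / A) *\<^sub>R re_part z) - cone_dist U (B *\<^sub>R re_part z)
                         - infnorm (B *\<^sub>R im_part z))"

definition step_space :: "real \<Rightarrow> real \<Rightarrow> (real^'k) set \<Rightarrow> 'k::finite testfun set" where
  "step_space A B U = {f. entire f \<and> bdd_above (range (weighted A B U f))}"

definition step_norm :: "real \<Rightarrow> real \<Rightarrow> (real^'k) set \<Rightarrow> 'k::finite testfun \<Rightarrow> real" where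
  "step_norm A B U f = (SUP z. weighted A B U f z)"

definition test_space :: "(real^'k) set \<Rightarrow> 'k::finite testfun set" where
  "test_space U = \<Union>{step_space A B W | A B W. A > 0 \<and> B > 0 \<and> conic_nbhd W U}"

text \<open>
  The locally convex inductive limit topology: a base of neighbourhoods of \<open>0\<close> is formed by the
  absolutely convex sets whose trace on every step space is a neighbourhood of \<open>0\<close> there.
\<close>

definition abs_convex :: "'k::finite testfun set \<Rightarrow> bool" where
  "abs_convex V \<longleftrightarrow>
     (\<forall>f\<in>V. \<forall>g\<in>V. \<forall>a b. norm a + norm b \<le> 1 \<longrightarrow> (\<lambda>z. a * f z + b * g z) \<in> V)"

definition zero_nbhd :: "(real^'k) set \<Rightarrow> 'k::finite testfun set \<Rightarrow> bool" where
  "zero_nbhd U V \<longleftrightarrow> V \<subseteq> test_space U \<and> abs_convex V \<and>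
     (\<forall>A>0. \<forall>B>0. \<forall>W. conic_nbhd W U \<longrightarrow>
        (\<exists>e>0. {f \<in> step_space A B W. step_norm A B W f < e} \<subseteq> V))"

definition test_topology :: "(real^'k) set \<Rightarrow> 'k::finite testfun topology" where
  "test_topology U = topology (\<lambda>X. X \<subseteq> test_space U \<and>
     (\<forall>f\<in>X. \<exists>V. zero_nbhd U V \<and> f +o V \<subseteq> X))"

lemma zero_nbhd_Int: "zero_nbhd U V \<Longrightarrow> zero_nbhd U V' \<Longrightarrow> zero_nbhd U (V \<inter> V')"
  unfolding zero_nbhd_def
proof (intro conjI allI impI; (elim conjE)?)
  fix A B :: real and W
  assume "0 < A" "0 < B" "conic_nbhd W U"
    and "\<forall>A>0. \<forall>B>0. \<forall>W. conic_nbhd W U \<longrightarrow>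
           (\<exists>e>0. {f \<in> step_space A B W. step_norm A B W f < e} \<subseteq> V)"
    and "\<forall>A>0. \<forall>B>0. \<forall>W. conic_nbhd W U \<longrightarrow>
           (\<exists>e>0. {f \<in> step_space A B W. step_norm A B W f < e} \<subseteq> V')"
  then obtain e e' where "e > 0" "{f \<in> step_space A B W. step_norm A B W f < e} \<subseteq> V"
    and "e' > 0" "{f \<in> step_space A B W. step_norm A B W f < e'} \<subseteq> V'"
    by meson
  then show "\<exists>e>0. {f \<in> step_space A B W. step_norm A B W f < e} \<subseteq> V \<inter> V'"
    by (intro exI[of _ "min e e'"]) auto
qed (auto simp: abs_convex_def)

lemma openin_test_topology:
  "openin (test_topology U) X \<longleftrightarrow>
     X \<subseteq> test_space U \<and> (\<forall>f\<in>X. \<exists>V. zero_nbhd U V \<and> f +o V \<subseteq> X)"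
proof -
  let ?P = "\<lambda>X. X \<subseteq> test_space U \<and> (\<forall>f\<in>X. \<exists>V. zero_nbhd U V \<and> f +o V \<subseteq> X)"
  have "?P (S \<inter> T)" if S: "?P S" and T: "?P T" for S T
  proof (intro conjI ballI)
    show "S \<inter> T \<subseteq> test_space U" using S by blast
    fix f assume "f \<in> S \<inter> T"
    with S T obtain V V' where "zero_nbhd U V" "f +o V \<subseteq> S" "zero_nbhd U V'" "f +o V' \<subseteq> T"
      by (meson IntD1 IntD2)
    then show "\<exists>V. zero_nbhd U V \<and> f +o V \<subseteq> S \<inter> T"
      by (intro exI[of _ "V \<inter> V'"]) (auto simp: elt_set_plus_def intro: zero_nbhd_Int)
  qed
  moreover have "?P (\<Union>\<K>)" if "\<forall>S\<in>\<K>. ?P S" for \<K>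
    using that by (meson Sup_least Sup_upper UnionE order_trans)
  ultimately have "istopology ?P"
    unfolding istopology_def by blast
  then show ?thesis
    unfolding test_topology_def by (simp add: topology_inverse')
qed

subsection \<open>Continuous duals and restriction\<close>

type_synonym 'k functional = "'k testfun \<Rightarrow> complex"

text \<open>
  A functional on \<open>test_space U\<close> is represented by its extension by \<open>0\<close> to all functions.
\<close>

definition dual_space :: "(real^'k) set \<Rightarrow> 'k::finite functional set" where
  "dual_space U = {L.
     (\<forall>f\<in>test_space U. \<forall>g\<in>test_space U. L (f + g) = L f + L g) \<and>
     (\<forall>c. \<forall>f\<in>test_space U. L (\<lambda>z. c * f z) = c * L f) \<and>
     continuous_map (test_topology U) euclidean L \<and>
     (\<forall>f. f \<notin> test_space U \<longrightarrow> L f = 0)}"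

definition restr :: "(real^'k) set \<Rightarrow> 'k::finite functional \<Rightarrow> 'k functional" where
  "restr K u = (\<lambda>f. if f \<in> test_space K then u f else 0)"


subsection \<open>Ultrafunctionals\<close>

definition proper_closed_cones :: "(real^'k) set \<Rightarrow> (real^'k) set set" where
  "proper_closed_cones M = {K. proper_cone K \<and> closed K \<and> K \<subseteq> M}"

type_synonym 'k family = "(real^'k) set \<Rightarrow> 'k functional"

definition family_scale :: "complex \<Rightarrow> 'k::finite family \<Rightarrow> 'k family" where
  "family_scale c v = (\<lambda>K f. c * v K f)"

interpretation family: vector_space "family_scale :: complex \<Rightarrow> 'k::finite family \<Rightarrow> 'k family"
  by unfold_locales (auto simp: family_scale_def fun_eq_iff algebra_simps)

definition direct_sum :: "(real^'k) set \<Rightarrow> 'k::finite family set" where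
  "direct_sum M = {v. finite {K. v K \<noteq> 0} \<and>
     (\<forall>K\<in>proper_closed_cones M. v K \<in> dual_space K) \<and>
     (\<forall>K. K \<notin> proper_closed_cones M \<longrightarrow> v K = 0)}"

definition summand :: "(real^'k) set \<Rightarrow> 'k::finite functional \<Rightarrow> 'k family" where
  "summand K u = (\<lambda>L. if L = K then u else 0)"

definition relations :: "(real^'k) set \<Rightarrow> 'k::finite family set" where
  "relations M = family.span {summand K' u - summand K (restr K u) | K' K u.
     K' \<in> proper_closed_cones M \<and> K \<in> proper_closed_cones M \<and> K' \<subseteq> K \<and> u \<in> dual_space K'}"

text \<open>
  The quotient is the set of cosets. The sum of two cosets in the quotient is their elementwise
  sum, that is, \<open>+\<close> on sets.
\<close>

definition ultra :: "(real^'k) set \<Rightarrow> 'k::finite family set set" where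
  "ultra M = (\<lambda>v. v +o relations M) ` direct_sum M"

text \<open>
  For closed cones \<open>K' \<subseteq> K\<close> the inclusion of index sets makes \<open>direct_sum K'\<close> a subspace of
  \<open>direct_sum K\<close> (extension by \<open>0\<close>), and the induced map sends \<open>v +o relations K'\<close> to
  \<open>v +o relations K\<close>. As \<open>relations K' \<subseteq> relations K\<close>, the latter coset is
  \<open>(v +o relations K') + relations K\<close>.
\<close>

definition canonical_map :: "(real^'k) set \<Rightarrow> 'k::finite family set \<Rightarrow> 'k family set" where
  "canonical_map K u = u + relations K"

definition carried_by :: "'k::finite family set \<Rightarrow> (real^'k) set \<Rightarrow> bool" where
  "carried_by u K \<longleftrightarrow> u \<in> canonical_map UNIV ` ultra K"

lemma relations_mono: "K' \<subseteq> K \<Longrightarrow> relations K' \<subseteq> relations K"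
  unfolding relations_def by (rule family.span_mono) (unfold proper_closed_cones_def, blast)

lemma canonical_map_coset:
  assumes "K' \<subseteq> K"
  shows "canonical_map K (v +o relations K') = v +o relations K"
proof -
  have "a + b \<in> relations K" if "a \<in> relations K'" "b \<in> relations K" for a b
    using that relations_mono[OF assms] unfolding relations_def by (auto intro: family.span_add)
  moreover have "0 \<in> relations K'"
    unfolding relations_def by (rule family.span_zero)
  ultimately have "relations K' + relations K = relations K"
    unfolding set_plus_def by (force intro: bexI[where x = 0])
  then show ?thesis
    unfolding canonical_map_def by (simp add: set_plus_rearrange3)
qed

lemma ultra_add:
  "(v +o relations M) + (w +o relations M) = (v + w) +o relations M"
proof -
  have "relations M + relations M = relations M"
    using canonical_map_coset[OF order_refl, of M 0] by (simp add: canonical_map_def)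
  then show ?thesis
    by (simp add: set_plus_rearrange)
qed

end

theory Submission
  imports Defs "HOL-Complex_Analysis.Great_Picard"
begin

text \<open>
  Everything reduces to one proper closed cone \<open>K = U1 \<union> U2\<close> with closed cones \<open>U1\<close>, \<open>U2\<close>: every
  continuous functional \<open>u\<close> on \<open>test_space K\<close> is a sum of restrictions of continuous functionals on
  \<open>test_space U1\<close> and \<open>test_space U2\<close> (\<open>dual_space_decompose\<close>). Given this, an element of the direct
  sum over the proper closed cones in \<open>K1 \<union> K2\<close> is split at every cone \<open>K\<close> of its finite support
  along \<open>K = (K \<inter> K1) \<union> (K \<inter> K2)\<close>, and the defining relations of the inductive limit identify each
  restriction with the functional it comes from. Closed cones contain the origin, so the two
  intersections are nonempty and thus again proper closed cones.

  For a single cone, the map \<open>f \<mapsto> (f, f)\<close> embeds \<open>test_space K\<close> in the product of the two larger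
  test spaces, and \<open>u\<close> has to be extended from the diagonal to the product. By the Hahn-Banach
  theorem this is possible as soon as \<open>u\<close> is bounded on the diagonal part of some product of
  neighbourhoods of \<open>0\<close>. The distance to a union of cones is the minimum of the two distances, so a
  function obeying growth bounds near \<open>U1\<close> and near \<open>U2\<close> obeys one near \<open>K\<close>; but the bounds involved
  vary over an inductive limit, and a neighbourhood of \<open>0\<close> there has to treat all steps at once.

  Compactness overcomes this. The growth allowed in one step is smaller than that allowed in the
  next by an exponentially decaying factor, so by Montel's theorem a family bounded in one step has
  a sequence converging in the norm of the next (\<open>step_compact\<close>). Countably many steps suffice, and
  one enlarges two bounds \<open>b1 n\<close> and \<open>b2 n\<close> along them, each time by a small multiple of the growth
  allowed in the next step, keeping the invariant that entire functions dominated by both bounds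
  satisfy \<open>\<bar>u f\<bar> < 1\<close> (\<open>small_bound_step\<close>, \<open>small_bounds_exist\<close>): were every multiple too large, a
  limit of counterexamples would violate the invariant of the previous stage. The entire functions
  dominated by some \<open>b1 n\<close>, respectively some \<open>b2 n\<close>, are the desired neighbourhoods.
\<close>

section \<open>The Hahn-Banach theorem for absolutely convex sets\<close>

text \<open>
  Scalar multiplication is a parameter, so that a complex vector space can be viewed as a real one
  with the restricted scalars; \<open>complex_hahn_banach\<close> does this.
\<close>

locale real_scaling = vector_space scale for scale :: "real \<Rightarrow> 'v::ab_group_add \<Rightarrow> 'v"
begin

text \<open>
  For a positive factor the inequality implies equality, by applying it to the inverse factor; it is
  the form that is inherited by infima.
\<close>

definition sublinear_on :: "'v set \<Rightarrow> ('v \<Rightarrow> real) \<Rightarrow> bool" where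
  "sublinear_on E q \<longleftrightarrow>
     (\<forall>x\<in>E. \<forall>y\<in>E. q (x + y) \<le> q x + q y) \<and> (\<forall>x\<in>E. \<forall>c>0. q (scale c x) \<le> c * q x)"

definition linear_form_on :: "'v set \<Rightarrow> ('v \<Rightarrow> real) \<Rightarrow> bool" where
  "linear_form_on E g \<longleftrightarrow>
     (\<forall>x\<in>E. \<forall>y\<in>E. g (x + y) = g x + g y) \<and> (\<forall>x\<in>E. \<forall>c. g (scale c x) = c * g x)"

lemma sublinear_on_scale:
  assumes "sublinear_on E q" "subspace E" "x \<in> E" "c > 0"
  shows "q (scale c x) = c * q x"
proof (rule antisym)
  show "q (scale c x) \<le> c * q x"
    using assms by (auto simp: sublinear_on_def)
  have "q (scale (1/c) (scale c x)) \<le> (1/c) * q (scale c x)"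
    using assms by (simp only: sublinear_on_def subspace_scale zero_less_divide_1_iff)
  then show "c * q x \<le> q (scale c x)"
    using \<open>c > 0\<close> by (simp add: field_simps)
qed

lemma sublinear_on_zero:
  assumes "sublinear_on E q" "subspace E"
  shows "q 0 = 0"
  using sublinear_on_scale[OF assms, of 0 2] subspace_0[OF assms(2)] by simp

lemma sublinear_on_minus:
  assumes "sublinear_on E q" "subspace E" "x \<in> E"
  shows "- q (- x) \<le> q x"
proof -
  have "q (x + - x) \<le> q x + q (- x)"
    using assms subspace_neg unfolding sublinear_on_def by blast
  then show ?thesis
    using sublinear_on_zero[OF assms(1,2)] by simp
qed

text \<open>
  For fixed \<open>x\<close>, the infimum over \<open>t \<ge> 0\<close> of \<open>r (z + t x) - t r x\<close> is again a sublinear function of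
  \<open>z\<close> below \<open>r\<close>. By minimality it equals \<open>r\<close>, and comparison with \<open>t = 1\<close> gives the missing half of
  additivity.
\<close>

lemma minimal_sublinear_is_linear:
  assumes E: "subspace E" and r: "sublinear_on E r"
    and min: "\<And>r'. sublinear_on E r' \<Longrightarrow> (\<forall>x\<in>E. r' x \<le> r x) \<Longrightarrow> \<forall>x\<in>E. r' x = r x"
  shows "linear_form_on E r"
proof -
  note [simp] = subspace_add[OF E] subspace_scale[OF E] subspace_neg[OF E] subspace_0[OF E]
  have sub: "r (x + y) \<le> r x + r y" if "x \<in> E" "y \<in> E" for x y
    using r that by (auto simp: sublinear_on_def)
  have add: "r (y + x) = r y + r x" if x: "x \<in> E" and y: "y \<in> E" for x y
  proof -
    define slope where "slope z t = r (z + scale t x) - t * r x" for z t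
    define r' where "r' z = (INF t\<in>{0..}. slope z t)" for z
    have scale_x: "r (scale t x) = t * r x" if "t \<ge> 0" for t
      using that sublinear_on_scale[OF r E x, of t] sublinear_on_zero[OF r E]
      by (cases "t = 0") auto
    have lower: "- r (- z) \<le> slope z t" if "z \<in> E" "t \<ge> 0" for z t
      using sub[of "z + scale t x" "- z"] that x scale_x[of t] by (simp add: slope_def)
    have bdd: "bdd_below (slope z ` {0..})" if "z \<in> E" for z
      using lower[OF that] by (intro bdd_belowI2[of _ "- r (- z)"]) auto
    have r'_le: "r' z \<le> slope z t" if "z \<in> E" "t \<ge> 0" for z t
      unfolding r'_def using that bdd by (intro cINF_lower) auto
    have "sublinear_on E r'"
      unfolding sublinear_on_def
    proof (intro conjI ballI allI impI)
      fix a b assume ab: "a \<in> E" "b \<in> E"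
      have *: "r' (a + b) \<le> slope a s + slope b t" if "s \<ge> 0" "t \<ge> 0" for s t
      proof -
        have "r' (a + b) \<le> slope (a + b) (s + t)"
          using ab that by (intro r'_le) auto
        also have "\<dots> \<le> slope a s + slope b t"
          using sub[of "a + scale s x" "b + scale t x"] ab x
          by (simp add: slope_def algebra_simps)
        finally show ?thesis .
      qed
      have "r' (a + b) - slope a s \<le> r' b" if "s \<ge> 0" for s
        unfolding r'_def[of b] using *[OF that] by (intro cINF_greatest) (auto simp: algebra_simps)
      then have "r' (a + b) - r' b \<le> r' a"
        unfolding r'_def[of a] by (intro cINF_greatest) (auto simp: algebra_simps)
      then show "r' (a + b) \<le> r' a + r' b" by simp
    next
      fix a and c :: real assume a: "a \<in> E" and c: "c > 0"
      have "r' (scale c a) / c \<le> r' a"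
        unfolding r'_def[of a]
      proof (rule cINF_greatest)
        fix t :: real assume "t \<in> {0..}"
        then have "r' (scale c a) \<le> slope (scale c a) (c * t)"
          using a c by (intro r'_le) auto
        also have "\<dots> = c * slope a t"
          using sublinear_on_scale[OF r E, of "a + scale t x" c] a x c
          by (simp add: slope_def algebra_simps)
        finally show "r' (scale c a) / c \<le> slope a t"
          using c by (simp add: field_simps)
      qed auto
      then show "r' (scale c a) \<le> c * r' a"
        using c by (simp add: field_simps)
    qed
    moreover have "\<forall>z\<in>E. r' z \<le> r z"
      using r'_le[where t = 0] by (auto simp: slope_def)
    ultimately have "r' y = r y"
      using min y by blast
    then have "r y \<le> r (y + x) - r x"
      using r'_le[OF y, of 1] by (simp add: slope_def)
    with sub[OF y x] show ?thesis by simp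
  qed
  have neg: "r (- x) = - r x" if "x \<in> E" for x
    using add[of "- x" x] that sublinear_on_zero[OF r E] by simp
  have "r (scale c x) = c * r x" if x: "x \<in> E" for c x
  proof -
    consider "c > 0" | "c = 0" | "c < 0" by linarith
    then show ?thesis
    proof cases
      case 3
      then show ?thesis
        using sublinear_on_scale[OF r E x, of "- c"] neg[of "scale c x"] x by simp
    qed (use sublinear_on_scale[OF r E x] sublinear_on_zero[OF r E] in auto)
  qed
  with add show ?thesis by (auto simp: linear_form_on_def)
qed

text \<open>
  The infimum of a chain of sublinear functions below \<open>q\<close> is finite, being bounded below by
  \<open>x \<mapsto> - q (- x)\<close>, and again sublinear, so Zorn's lemma yields a minimal one.
\<close>

lemma linear_form_below_sublinear:
  assumes E: "subspace E" and q: "sublinear_on E q"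
  shows "\<exists>g. linear_form_on E g \<and> (\<forall>x\<in>E. g x \<le> q x)"
proof -
  \<comment> \<open>With the value 0 prescribed outside \<open>E\<close>, comparison on \<open>E\<close> becomes the pointwise order of functions.\<close>
  define A where "A = {r. sublinear_on E r \<and> (\<forall>x\<in>E. r x \<le> q x) \<and> (\<forall>x. x \<notin> E \<longrightarrow> r x = 0)}"
  have restrict: "(\<lambda>x. if x \<in> E then r x else 0) \<in> A"
    if "sublinear_on E r" "\<forall>x\<in>E. r x \<le> q x" for r
    using that subspace_add[OF E] subspace_scale[OF E] by (auto simp: A_def sublinear_on_def)
  have "\<exists>m\<in>A. \<forall>a\<in>A. a \<le> m \<longrightarrow> a = m"
  proof (rule predicate_Zorn)
    show "partial_order_on A (relation_of (\<lambda>a b. b \<le> a) A)"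
      by (rule partial_order_on_relation_ofI) auto
    fix C assume C: "C \<in> Chains (relation_of (\<lambda>a b. b \<le> a) A)"
    then have CA: "C \<subseteq> A" and tot: "\<And>a b. a \<in> C \<Longrightarrow> b \<in> C \<Longrightarrow> a \<le> b \<or> b \<le> a"
      by (auto simp: Chains_def relation_of_def)
    show "\<exists>u\<in>A. \<forall>a\<in>C. u \<le> a"
    proof (cases "C = {}")
      case True
      then show ?thesis using restrict[OF q] by blast
    next
      case False
      define u where "u x = (INF r\<in>C. r x)" for x
      have lower: "- q (- x) \<le> r x" if "r \<in> C" "x \<in> E" for r x
      proof -
        have "- r (- x) \<le> r x" "r (- x) \<le> q (- x)"
          using that CA sublinear_on_minus[OF _ E] subspace_neg[OF E] by (auto simp: A_def)
        then show ?thesis by simp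
      qed
      have u_le: "u x \<le> r x" if "r \<in> C" "x \<in> E" for r x
        unfolding u_def using that lower
        by (intro cINF_lower bdd_belowI2[of _ "- q (- x)"]) auto
      have "sublinear_on E u"
        unfolding sublinear_on_def
      proof (intro conjI ballI allI impI)
        fix x y assume xy: "x \<in> E" "y \<in> E"
        have *: "u (x + y) \<le> r x + s y" if rs: "r \<in> C" "s \<in> C" for r s
        proof -
          obtain t where t: "t \<in> C" "t \<le> r" "t \<le> s"
            using tot[OF rs] rs by blast
          have "u (x + y) \<le> t (x + y)"
            using t xy subspace_add[OF E] by (intro u_le) auto
          also have "\<dots> \<le> t x + t y"
            using t CA xy by (auto simp: A_def sublinear_on_def)
          also have "\<dots> \<le> r x + s y"
            using t by (intro add_mono) (auto simp: le_fun_def)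
          finally show ?thesis .
        qed
        have "u (x + y) - r x \<le> u y" if "r \<in> C" for r
          unfolding u_def[of y] using *[OF that] False
          by (intro cINF_greatest) (auto simp: algebra_simps)
        then have "u (x + y) - u y \<le> u x"
          unfolding u_def[of x] using False by (intro cINF_greatest) (auto simp: algebra_simps)
        then show "u (x + y) \<le> u x + u y" by simp
      next
        fix x and c :: real assume x: "x \<in> E" and c: "c > 0"
        have "u (scale c x) / c \<le> u x"
          unfolding u_def[of x]
        proof (rule cINF_greatest[OF False])
          fix r assume r: "r \<in> C"
          then have "u (scale c x) \<le> r (scale c x)"
            using x subspace_scale[OF E] by (intro u_le) auto
          also have "\<dots> \<le> c * r x"
            using r CA x c by (auto simp: A_def sublinear_on_def)
          finally show "u (scale c x) / c \<le> r x"
            using c by (simp add: field_simps)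
        qed
        then show "u (scale c x) \<le> c * u x"
          using c by (simp add: field_simps)
      qed
      moreover have "\<forall>x\<in>E. u x \<le> q x"
      proof
        fix x assume x: "x \<in> E"
        obtain r where "r \<in> C" using False by blast
        with x show "u x \<le> q x"
          using u_le[of r x] CA by (force simp: A_def)
      qed
      ultimately have "(\<lambda>x. if x \<in> E then u x else 0) \<in> A"
        by (rule restrict)
      moreover have "(\<lambda>x. if x \<in> E then u x else 0) \<le> r" if "r \<in> C" for r
        using that CA u_le by (auto simp: le_fun_def A_def)
      ultimately show ?thesis by blast
    qed
  qed
  then obtain m where m: "m \<in> A" and min: "\<And>a. a \<in> A \<Longrightarrow> a \<le> m \<Longrightarrow> a = m"
    by blast
  have "linear_form_on E m"
  proof (rule minimal_sublinear_is_linear[OF E])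
    show "sublinear_on E m" using m by (simp add: A_def)
    fix r assume r: "sublinear_on E r" "\<forall>x\<in>E. r x \<le> m x"
    have "(\<lambda>x. if x \<in> E then r x else 0) \<in> A"
      using r m by (intro restrict) (force simp: A_def)+
    moreover have "(\<lambda>x. if x \<in> E then r x else 0) \<le> m"
      using r m by (auto simp: le_fun_def A_def)
    ultimately have "(\<lambda>x. if x \<in> E then r x else 0) = m" by (rule min)
    then show "\<forall>x\<in>E. r x = m x" by (metis (mono_tags))
  qed
  with m show ?thesis by (auto simp: A_def)
qed

text \<open>
  The infimum \<open>q x\<close> of all \<open>t + f y\<close> with \<open>y \<in> F\<close> and \<open>x - y \<in> t V\<close> merges the gauge of \<open>V\<close> and the
  given form into one sublinear function. A linear form below \<open>q\<close> is at most \<open>1\<close> on \<open>V\<close> and at most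
  \<open>f\<close> on the subspace \<open>F\<close>, hence equal to \<open>f\<close> there.
\<close>

lemma hahn_banach_convex_set:
  assumes E: "subspace E" and F: "subspace F" "F \<subseteq> E" and f: "linear_form_on F f"
    and VE: "V \<subseteq> E"
    and convex: "\<And>v w a b. v \<in> V \<Longrightarrow> w \<in> V \<Longrightarrow> a \<ge> 0 \<Longrightarrow> b \<ge> 0 \<Longrightarrow> a + b = 1 \<Longrightarrow>
                   scale a v + scale b w \<in> V"
    and absorb: "\<And>x. x \<in> E \<Longrightarrow> \<exists>t>0. \<exists>v\<in>V. x = scale t v"
    and f_le: "\<And>v. v \<in> V \<Longrightarrow> v \<in> F \<Longrightarrow> f v \<le> 1"
  shows "\<exists>g. linear_form_on E g \<and> (\<forall>x\<in>F. g x = f x) \<and> (\<forall>v\<in>V. g v \<le> 1)"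
proof -
  note [simp] = subspace_add[OF E] subspace_scale[OF E] subspace_neg[OF E] subspace_0[OF E]
    subspace_add[OF F(1)] subspace_scale[OF F(1)] subspace_neg[OF F(1)] subspace_0[OF F(1)]
    subspace_diff[OF E] subspace_diff[OF F(1)]
  have FE: "y \<in> E" if "y \<in> F" for y using that F by auto
  have f_add: "f (x + y) = f x + f y" if "x \<in> F" "y \<in> F" for x y
    using f that by (auto simp: linear_form_on_def)
  have f_scale: "f (scale c x) = c * f x" if "x \<in> F" for c x
    using f that by (auto simp: linear_form_on_def)
  have f_neg: "f (- x) = - f x" if "x \<in> F" for x
    using f_scale[OF that, of "-1"] by simp
  define T where "T x = {t + f y | t y v. t > 0 \<and> y \<in> F \<and> v \<in> V \<and> x = y + scale t v}" for x
  have TI: "t + f y \<in> T x" if "t > 0" "y \<in> F" "v \<in> V" "x = y + scale t v" for t x y v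
    using that by (auto simp: T_def)
  define q where "q x = Inf (T x)" for x
  have V_add: "\<exists>w\<in>V. scale s v + scale t v' = scale (s + t) w"
    if "s > 0" "t > 0" "v \<in> V" "v' \<in> V" for s t v v'
  proof
    have pos: "s + t > 0" using that by simp
    show "scale (s / (s + t)) v + scale (t / (s + t)) v' \<in> V"
      using that pos by (intro convex) (auto simp: add_divide_distrib[symmetric])
    show "scale s v + scale t v' = scale (s + t) (scale (s / (s + t)) v + scale (t / (s + t)) v')"
      using pos by (simp add: scale_right_distrib)
  qed
  have lower: "\<exists>b. \<forall>a\<in>T x. b \<le> a" if x: "x \<in> E" for x
  proof -
    obtain s w where s: "s > 0" "w \<in> V" "- x = scale s w"
      using absorb[of "- x"] x by auto
    have "- s \<le> t + f y" if ty: "t > 0" "y \<in> F" "v \<in> V" "x = y + scale t v" for t y v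
    proof -
      obtain w' where w': "w' \<in> V" "scale t v + scale s w = scale (t + s) w'"
        using V_add[OF ty(1) s(1) ty(3) s(2)] by auto
      have "- y = scale t v + scale s w"
        using that(4) by (simp flip: s(3))
      then have eq: "- y = scale (t + s) w'" using w' by simp
      have "scale (1 / (t + s)) (- y) \<in> F" using that by simp
      then have "w' \<in> F" using that s by (simp add: eq del: scale_minus_right)
      then have "f (- y) \<le> t + s"
        using f_le[OF w'(1)] f_scale[of w' "t + s"] that s by (simp add: eq)
      then show ?thesis using f_neg[OF \<open>y \<in> F\<close>] by simp
    qed
    then show ?thesis by (intro exI[of _ "- s"]) (auto simp: T_def)
  qed
  have bdd: "bdd_below (T x)" if "x \<in> E" for x
    using lower[OF that] by (auto simp: bdd_below_def)
  have ne: "T x \<noteq> {}" if "x \<in> E" for x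
  proof -
    obtain t v where "t > 0" "v \<in> V" "x = scale t v" using absorb[OF \<open>x \<in> E\<close>] by blast
    then have "t + f 0 \<in> T x" by (intro TI[of _ _ v]) auto
    then show ?thesis by blast
  qed
  have q_le: "q x \<le> a" if "x \<in> E" "a \<in> T x" for x a
    unfolding q_def using that bdd by (intro cInf_lower) auto
  have "sublinear_on E q"
    unfolding sublinear_on_def
  proof (intro conjI ballI allI impI)
    fix x y assume xy: "x \<in> E" "y \<in> E"
    have *: "q (x + y) \<le> a + b" if ab: "a \<in> T x" "b \<in> T y" for a b
    proof -
      obtain s x' v where 1: "a = s + f x'" "s > 0" "x' \<in> F" "v \<in> V" "x = x' + scale s v"
        using ab by (auto simp: T_def)
      obtain t y' w where 2: "b = t + f y'" "t > 0" "y' \<in> F" "w \<in> V" "y = y' + scale t w"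
        using ab by (auto simp: T_def)
      obtain z where z: "z \<in> V" "scale s v + scale t w = scale (s + t) z"
        using V_add[OF 1(2) 2(2) 1(4) 2(4)] by auto
      have "x + y = (x' + y') + scale (s + t) z"
        unfolding 1(5) 2(5) z(2)[symmetric] by (simp add: algebra_simps)
      moreover have "a + b = (s + t) + f (x' + y')"
        using 1 2 by (simp add: f_add)
      ultimately have "a + b \<in> T (x + y)"
        using TI[of "s + t" "x' + y'" z "x + y"] 1(2,3) 2(2,3) z(1) by simp
      then show ?thesis using xy by (intro q_le) auto
    qed
    have "q (x + y) - a \<le> q y" if "a \<in> T x" for a
      unfolding q_def[of y] using *[OF that] ne[OF xy(2)]
      by (intro cInf_greatest) (auto simp: algebra_simps)
    then have "q (x + y) - q y \<le> q x"
      unfolding q_def[of x] using ne[OF xy(1)] by (intro cInf_greatest) (auto simp: algebra_simps)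
    then show "q (x + y) \<le> q x + q y" by simp
  next
    fix x and c :: real assume x: "x \<in> E" and c: "c > 0"
    have "q (scale c x) / c \<le> q x"
      unfolding q_def[of x]
    proof (rule cInf_greatest[OF ne[OF x]])
      fix a assume "a \<in> T x"
      then obtain s x' v where 1: "a = s + f x'" "s > 0" "x' \<in> F" "v \<in> V" "x = x' + scale s v"
        by (auto simp: T_def)
      have "c * a = c * s + f (scale c x')"
        using 1 by (simp add: f_scale algebra_simps)
      moreover have "scale c x = scale c x' + scale (c * s) v"
        using 1 by (simp add: scale_right_distrib)
      ultimately have "c * a \<in> T (scale c x)"
        using TI[of "c * s" "scale c x'" v "scale c x"] 1(2-4) c by simp
      then have "q (scale c x) \<le> c * a" using x by (intro q_le) auto
      then show "q (scale c x) / c \<le> a" using c by (simp add: field_simps)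
    qed
    then show "q (scale c x) \<le> c * q x" using c by (simp add: field_simps)
  qed
  then obtain g where g: "linear_form_on E g" and gq: "\<And>x. x \<in> E \<Longrightarrow> g x \<le> q x"
    using linear_form_below_sublinear[OF E] by blast
  have "g v \<le> 1" if "v \<in> V" for v
  proof -
    have "1 + f 0 \<in> T v"
      using that by (intro TI[of _ _ v]) auto
    then show ?thesis
      using gq[of v] q_le[of v "1 + f 0"] f_scale[of 0 0] that VE by auto
  qed
  moreover have g_le_f: "g y \<le> f y" if y: "y \<in> F" for y
  proof (rule field_le_epsilon)
    fix e :: real assume "e > 0"
    obtain s v where s: "s > 0" "v \<in> V" "0 = scale s v" using absorb[of 0] by auto
    then have v0: "v = 0" by auto
    have "e + f y \<in> T y"
      using y \<open>e > 0\<close> s v0 by (intro TI[of _ _ 0]) auto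
    then show "g y \<le> f y + e"
      using gq[of y] q_le[of y "e + f y"] FE[OF y] by simp
  qed
  moreover have "f y \<le> g y" if y: "y \<in> F" for y
  proof -
    have "g (scale (-1) y) = -1 * g y"
      using g FE[OF y] unfolding linear_form_on_def by blast
    then show ?thesis using g_le_f[of "- y"] f_neg[OF y] y by simp
  qed
  ultimately show ?thesis using g by (intro exI[of _ g]) (auto intro: antisym)
qed

end

text \<open>
  The real part \<open>h\<close> of the form is extended first, and then \<open>h x - \<i> h (\<i> x)\<close> is complex linear.
  Both of its components are bounded by \<open>1\<close> on the balanced set \<open>V\<close>, whence the bound \<open>2\<close>.
\<close>

lemma complex_hahn_banach:
  fixes scale :: "complex \<Rightarrow> 'v::ab_group_add \<Rightarrow> 'v"
  assumes vs: "vector_space scale"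
    and E: "module.subspace scale E" and F: "module.subspace scale F" "F \<subseteq> E"
    and f_add: "\<And>x y. x \<in> F \<Longrightarrow> y \<in> F \<Longrightarrow> f (x + y) = f x + f y"
    and f_scale: "\<And>x c. x \<in> F \<Longrightarrow> f (scale c x) = c * f x"
    and VE: "V \<subseteq> E"
    and abs_convex: "\<And>v w a b. v \<in> V \<Longrightarrow> w \<in> V \<Longrightarrow> norm a + norm b \<le> 1 \<Longrightarrow>
                       scale a v + scale b w \<in> V"
    and absorb: "\<And>x. x \<in> E \<Longrightarrow> \<exists>t>0. \<exists>v\<in>V. x = scale (complex_of_real t) v"
    and f_le: "\<And>v. v \<in> V \<Longrightarrow> v \<in> F \<Longrightarrow> norm (f v) \<le> 1"
  shows "\<exists>g. (\<forall>x\<in>E. \<forall>y\<in>E. g (x + y) = g x + g y) \<and> (\<forall>x\<in>E. \<forall>c. g (scale c x) = c * g x) \<and>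
             (\<forall>x\<in>F. g x = f x) \<and> (\<forall>v\<in>V. norm (g v) \<le> 2)"
proof -
  interpret vector_space scale by (rule vs)
  define rscale where "rscale t = scale (complex_of_real t)" for t
  interpret re: real_scaling rscale
    by unfold_locales (auto simp: rscale_def algebra_simps)
  have sub: "re.subspace S" if "subspace S" for S
    using that by (auto simp: re.subspace_def subspace_def rscale_def)
  have "\<exists>h. re.linear_form_on E h \<and> (\<forall>x\<in>F. h x = Re (f x)) \<and> (\<forall>v\<in>V. h v \<le> 1)"
  proof (rule re.hahn_banach_convex_set)
    show "re.linear_form_on F (\<lambda>x. Re (f x))"
      by (simp add: re.linear_form_on_def f_add f_scale rscale_def)
    show "rscale a v + rscale b w \<in> V"
      if "v \<in> V" "w \<in> V" "a \<ge> 0" "b \<ge> 0" "a + b = 1" for v w a b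
      unfolding rscale_def using that by (intro abs_convex) auto
    show "\<exists>t>0. \<exists>v\<in>V. x = rscale t v" if "x \<in> E" for x
      using absorb[OF that] by (simp add: rscale_def)
    show "Re (f v) \<le> 1" if "v \<in> V" "v \<in> F" for v
      using f_le[OF that] complex_Re_le_cmod[of "f v"] by linarith
  qed (use E F VE sub in auto)
  then obtain h where h: "re.linear_form_on E h" and hf: "\<And>x. x \<in> F \<Longrightarrow> h x = Re (f x)"
    and hV: "\<And>v. v \<in> V \<Longrightarrow> h v \<le> 1" by blast
  note [simp] = subspace_add[OF E] subspace_scale[OF E] subspace_neg[OF E] subspace_0[OF E]
  have h_add: "h (x + y) = h x + h y" if "x \<in> E" "y \<in> E" for x y
    using h that by (auto simp: re.linear_form_on_def)
  have h_scale: "h (scale (complex_of_real t) x) = t * h x" if "x \<in> E" for t x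
    using h that by (auto simp: re.linear_form_on_def rscale_def)
  have h_neg: "h (- x) = - h x" if "x \<in> E" for x
    using h_scale[OF that, of "-1"] by simp
  define g where "g x = Complex (h x) (- h (scale \<i> x))" for x
  have g_add: "g (x + y) = g x + g y" if "x \<in> E" "y \<in> E" for x y
    using that by (simp add: g_def complex_eq_iff h_add scale_right_distrib)
  have g_scale: "g (scale c x) = c * g x" if x: "x \<in> E" for c x
  proof -
    have split: "h (scale c x) = Re c * h x + Im c * h (scale \<i> x)" if "x \<in> E" for c x
    proof -
      have c: "c = complex_of_real (Re c) + complex_of_real (Im c) * \<i>"
        by (simp add: complex_eq_iff)
      have "scale c x = scale (complex_of_real (Re c)) x + scale (complex_of_real (Im c)) (scale \<i> x)"
        by (subst c) (simp only: scale_left_distrib scale_scale)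
      then show ?thesis using that by (simp add: h_add h_scale del: scale_scale)
    qed
    show ?thesis
      using split[OF x, of c] split[OF x, of "\<i> * c"] x
      by (simp add: g_def complex_eq_iff)
  qed
  have "g x = f x" if x: "x \<in> F" for x
    using hf[OF x] hf[of "scale \<i> x"] f_scale[OF x] subspace_scale[OF F(1) x]
    by (simp add: g_def complex_eq_iff)
  moreover have "norm (g v) \<le> 2" if v: "v \<in> V" for v
  proof -
    have 1: "scale c v \<in> V" if "norm c = 1" for c
      using abs_convex[OF v v, of c 0] that by simp
    have vE: "v \<in> E" using v VE by auto
    have "\<bar>h v\<bar> \<le> 1"
      using hV[OF v] hV[OF 1[of "-1"]] h_neg[OF vE] by simp
    moreover have "\<bar>h (scale \<i> v)\<bar> \<le> 1"
      using hV[OF 1[of "\<i>"]] hV[OF 1[of "-\<i>"]] h_neg[of "scale \<i> v"] vE by simp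
    ultimately show ?thesis
      using cmod_le[of "g v"] by (simp add: g_def)
  qed
  ultimately show ?thesis using g_add g_scale by blast
qed

section \<open>Entire functions and Montel's theorem\<close>

lemma norm_vector_scalar_mult: "norm (c *s v) = norm c * norm v" for v :: "complex^'k"
  by (simp add: norm_vec_def L2_set_right_distrib norm_mult)

lemma bounded_linear_complex_line: "bounded_linear (\<lambda>c. c *s v)" for v :: "complex^'k"
proof (rule bounded_linear_intro)
  show "norm (c *s v) \<le> norm c * norm v" for c
    by (simp add: norm_vector_scalar_mult)
qed (auto simp: vec_eq_iff algebra_simps)

lemma entire_lincomb:
  assumes "entire f" "entire g"
  shows "entire (\<lambda>z. a * f z + b * g z)"
  unfolding entire_def
proof
  fix z
  obtain D D' where "(f has_derivative D) (at z)" "\<forall>c v. D (c *s v) = c * D v"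
    "(g has_derivative D') (at z)" "\<forall>c v. D' (c *s v) = c * D' v"
    using assms unfolding entire_def by meson
  then show "\<exists>D. ((\<lambda>z. a * f z + b * g z) has_derivative D) (at z) \<and>
      (\<forall>c v. D (c *s v) = c * D v)"
    by (intro exI[of _ "\<lambda>v. a * D v + b * D' v"])
       (auto intro!: has_derivative_add has_derivative_mult_right simp: algebra_simps)
qed

lemma entire_diff: "entire f \<Longrightarrow> entire g \<Longrightarrow> entire (\<lambda>z. f z - g z)"
  using entire_lincomb[of f g 1 "-1"] by simp

lemma entire_along_line:
  fixes f :: "'k::finite testfun"
  assumes "(f has_derivative D) (at (z + t *s v))" "\<And>c v. D (c *s v) = c * D v"
  shows "((\<lambda>t. f (z + t *s v)) has_field_derivative D v) (at t)"
proof -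
  have line: "((\<lambda>t. z + t *s v) has_derivative (\<lambda>c. c *s v)) (at t)"
    using has_derivative_add[OF has_derivative_const[of z "at t"]
        bounded_linear_imp_has_derivative[OF bounded_linear_complex_line[of v], of "at t"]]
    by simp
  have "((\<lambda>t. f (z + t *s v)) has_derivative (\<lambda>c. D (c *s v))) (at t)"
    using diff_chain_at[OF line assms(1)] by (simp add: o_def)
  then show ?thesis
    by (simp add: has_field_derivative_def assms(2) mult_commute_abs)
qed

text \<open>
  The derivative in the direction of a unit vector \<open>w\<close> is the derivative of the function
  \<open>t \<mapsto> f (z + t w)\<close> of one variable, to which Cauchy's inequality on the unit disc applies.
\<close>

lemma entire_Cauchy_estimate:
  assumes f: "entire f" and D: "(f has_derivative D) (at z)" "\<And>c v. D (c *s v) = c * D v"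
    and bound: "\<And>w. w \<in> cball z 1 \<Longrightarrow> norm (f w) \<le> M"
  shows "norm (D v) \<le> M * norm v"
proof (cases "v = 0")
  case True
  then show ?thesis
    using D(2)[of 0 v] by simp
next
  case False
  define w where "w = complex_of_real (1 / norm v) *s v"
  have nw: "norm w = 1"
    using False by (simp add: w_def norm_vector_scalar_mult norm_divide)
  have v: "v = complex_of_real (norm v) *s w"
    using False by (simp add: w_def vec_eq_iff)
  define g where "g t = f (z + t *s w)" for t
  have "\<exists>d. (g has_field_derivative d) (at t)" for t
    using f unfolding entire_def g_def by (metis entire_along_line)
  then have hol: "g holomorphic_on UNIV"
    unfolding holomorphic_on_def field_differentiable_def by (auto intro: has_field_derivative_at_within)
  have "(g has_field_derivative D w) (at 0)"
    unfolding g_def using D by (intro entire_along_line) auto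
  then have "deriv g 0 = D w" by (rule DERIV_imp_deriv)
  moreover have "norm ((deriv ^^ 1) g 0) \<le> fact 1 * M / 1 ^ 1"
  proof (rule Cauchy_inequality)
    show "norm (g t) \<le> M" if "norm (0 - t) = 1" for t
      using that nw unfolding g_def by (intro bound) (simp add: dist_norm norm_vector_scalar_mult)
  qed (use hol holomorphic_on_subset holomorphic_on_imp_continuous_on in \<open>auto intro: continuous_on_subset\<close>)
  ultimately have "norm (D w) \<le> M" by simp
  then have "norm v * norm (D w) \<le> norm v * M"
    by (intro mult_left_mono) auto
  moreover have "norm (D v) = norm v * norm (D w)"
    by (subst v) (simp only: D(2) norm_mult, simp)
  ultimately show ?thesis by (simp add: mult.commute)
qed

text \<open>
  By the Cauchy estimate, locally uniform convergence of the functions forces locally uniform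
  convergence of their derivatives, so limit and derivative may be interchanged; complex linearity
  of the derivative passes to the limit.
\<close>

lemma entire_uniform_limit:
  fixes f :: "nat \<Rightarrow> 'k::finite testfun"
  assumes f: "\<And>n. entire (f n)"
    and lim: "\<And>R. uniform_limit (cball 0 R) f g sequentially"
  shows "entire g"
proof -
  obtain D where D: "\<And>n z. (f n has_derivative D n z) (at z)"
    and D_scale: "\<And>n z c v. D n z (c *s v) = c * D n z v"
    using f unfolding entire_def by metis
  have Cauchy_D: "\<exists>N. \<forall>n\<ge>N. \<forall>m\<ge>N. \<forall>z\<in>cball 0 R. \<forall>v. norm (D n z v - D m z v) \<le> e * norm v"
    if "e > 0" for e R
  proof -
    have "uniformly_Cauchy_on (cball 0 (R + 1)) f"
      using lim by (intro uniformly_convergent_Cauchy) (auto simp: uniformly_convergent_on_def)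
    then obtain N where N: "\<And>z n m. z \<in> cball 0 (R + 1) \<Longrightarrow> n \<ge> N \<Longrightarrow> m \<ge> N \<Longrightarrow>
        dist (f n z) (f m z) < e"
      using \<open>e > 0\<close> unfolding uniformly_Cauchy_on_def by metis
    have "norm (D n z v - D m z v) \<le> e * norm v"
      if nm: "n \<ge> N" "m \<ge> N" and z: "z \<in> cball 0 R" for n m z v
    proof (rule entire_Cauchy_estimate[where f = "\<lambda>z. f n z - f m z"
          and D = "\<lambda>v. D n z v - D m z v" and z = z])
      fix w assume "w \<in> cball z 1"
      then have "w \<in> cball 0 (R + 1)"
        using z norm_triangle_ineq2[of w z] by (auto simp: dist_norm norm_minus_commute)
      then show "norm (f n w - f m w) \<le> e"
        using N nm by (force simp: dist_norm)
    qed (use f D D_scale in \<open>auto intro: entire_diff has_derivative_diff simp: algebra_simps\<close>)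
    then show ?thesis by blast
  qed
  define D' where "D' z v = lim (\<lambda>n. D n z v)" for z v
  have D'_lim: "(\<lambda>n. D n z v) \<longlonglongrightarrow> D' z v" for z v
  proof -
    have "Cauchy (\<lambda>n. D n z v)"
      unfolding Cauchy_def
    proof (intro allI impI)
      fix e :: real assume "e > 0"
      define d where "d = e / (2 * (norm v + 1))"
      have d: "d > 0" using \<open>e > 0\<close> by (simp add: d_def add_nonneg_pos)
      have "d * norm v \<le> d * (norm v + 1)" using d by simp
      also have "\<dots> = e / 2" unfolding d_def by (simp add: field_simps add_nonneg_eq_0_iff)
      also have "\<dots> < e" using \<open>e > 0\<close> by simp
      finally have small: "d * norm v < e" .
      obtain N where "\<forall>n\<ge>N. \<forall>m\<ge>N. \<forall>z\<in>cball 0 (norm z). \<forall>v. norm (D n z v - D m z v) \<le> d * norm v"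
        using Cauchy_D[OF d, of "norm z"] by blast
      then have "\<forall>n\<ge>N. \<forall>m\<ge>N. dist (D n z v) (D m z v) < e"
        using small unfolding dist_norm by (meson dual_order.refl le_less_trans mem_cball_0)
      then show "\<exists>N. \<forall>m\<ge>N. \<forall>n\<ge>N. dist (D m z v) (D n z v) < e" by blast
    qed
    then show ?thesis
      unfolding D'_def using Cauchy_convergent convergent_LIMSEQ_iff by blast
  qed
  show ?thesis
    unfolding entire_def
  proof (intro allI exI conjI)
    fix z c v
    have "(\<lambda>n. D n z (c *s v)) \<longlonglongrightarrow> c * D' z v"
      unfolding D_scale by (intro tendsto_intros D'_lim)
    then show "D' z (c *s v) = c * D' z v"
      using D'_lim LIMSEQ_unique by blast
  next
    fix z :: "complex^'k"
    define S where "S = ball (0 :: complex^'k) (norm z + 1)"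
    have "z \<in> S" "open S" by (auto simp: S_def)
    have "\<exists>h. \<forall>x\<in>S. (\<lambda>n. f n x) \<longlonglongrightarrow> h x \<and> (h has_derivative D' x) (at x within S)"
    proof (rule has_derivative_sequence)
      show "convex S" by (simp add: S_def)
      show "(f n has_derivative D n x) (at x within S)" for n x
        using D by (rule has_derivative_at_withinI)
      show "z \<in> S" by fact
      show "(\<lambda>n. f n z) \<longlonglongrightarrow> g z"
        by (rule tendsto_uniform_limitI[OF lim[of "norm z"]]) simp
      fix e :: real assume "e > 0"
      obtain N where N: "\<forall>n\<ge>N. \<forall>m\<ge>N. \<forall>x\<in>cball 0 (norm z + 1). \<forall>v.
          norm (D n x v - D m x v) \<le> e * norm v"
        using Cauchy_D[OF \<open>e > 0\<close>, of "norm z + 1"] by blast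
      have "norm (D n x v - D' x v) \<le> e * norm v" if "n \<ge> N" "x \<in> S" for n x v
      proof (rule Lim_norm_ubound)
        show "(\<lambda>m. D n x v - D m x v) \<longlonglongrightarrow> D n x v - D' x v"
          by (intro tendsto_intros D'_lim)
        show "\<forall>\<^sub>F m in sequentially. norm (D n x v - D m x v) \<le> e * norm v"
          using N that unfolding S_def by (auto intro!: eventually_sequentiallyI[of N])
      qed simp
      then show "\<forall>\<^sub>F n in sequentially. \<forall>x\<in>S. \<forall>v. norm (D n x v - D' x v) \<le> e * norm v"
        by (intro eventually_sequentiallyI[of N]) auto
    qed
    then obtain h where h: "\<And>x. x \<in> S \<Longrightarrow> (\<lambda>n. f n x) \<longlonglongrightarrow> h x"
      "\<And>x. x \<in> S \<Longrightarrow> (h has_derivative D' x) (at x within S)" by blast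
    have "h x = g x" if "x \<in> S" for x
      by (rule LIMSEQ_unique[OF h(1)[OF that]])
         (rule tendsto_uniform_limitI[OF lim[of "norm x"]], simp)
    then show "(g has_derivative D' z) (at z)"
      using h(2)[OF \<open>z \<in> S\<close>] \<open>z \<in> S\<close> \<open>open S\<close>
      by (metis at_within_open has_derivative_transform_within_open)
  qed
qed

text \<open>
  The Cauchy estimate turns local boundedness into a local Lipschitz condition with a common
  constant, so Arzela-Ascoli gives convergent subsequences on each ball, and a diagonal argument one
  for all balls.
\<close>

lemma entire_Montel:
  fixes f :: "nat \<Rightarrow> 'k::finite testfun"
  assumes f: "\<And>n. entire (f n)"
    and bounded: "\<And>R. \<exists>M. \<forall>n. \<forall>z\<in>cball 0 R. norm (f n z) \<le> M"
  obtains r g where "strict_mono (r :: nat \<Rightarrow> nat)" "entire g"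
    "\<And>R. uniform_limit (cball 0 R) (\<lambda>n. f (r n)) g sequentially"
proof -
  have equicontinuous: "\<exists>M\<ge>0. \<forall>n. \<forall>x\<in>cball 0 R. \<forall>y\<in>cball 0 R. norm (f n x - f n y) \<le> M * norm (x - y)"
    for R
  proof -
    obtain M where M: "\<And>n z. z \<in> cball 0 (R + 1) \<Longrightarrow> norm (f n z) \<le> M"
      using bounded by meson
    have "norm (f n x - f n y) \<le> max 0 M * norm (x - y)"
      if x: "x \<in> cball 0 R" and y: "y \<in> cball 0 R" for n x y
    proof -
      obtain D where D: "\<And>z. (f n has_derivative D z) (at z)" "\<And>z c v. D z (c *s v) = c * D z v"
        using f[of n] unfolding entire_def by metis
      show ?thesis
      proof (rule differentiable_bound[OF convex_cball _ _ x y])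
        fix z :: "complex^'k" assume z: "z \<in> cball 0 R"
        show "(f n has_derivative D z) (at z within cball 0 R)"
          by (rule has_derivative_at_withinI[OF D(1)])
        have "norm (f n w) \<le> M" if "w \<in> cball z 1" for w
          using z that norm_triangle_ineq2[of w z]
          by (intro M) (auto simp: dist_norm norm_minus_commute)
        then have "norm (D z v) \<le> M * norm v" for v
          using entire_Cauchy_estimate[OF f D] by blast
        then have "norm (D z v) \<le> max 0 M * norm v" for v
          by (smt (verit) mult_right_mono norm_ge_zero)
        then show "onorm (D z) \<le> max 0 M"
          by (intro onorm_bound) auto
      qed
    qed
    then show ?thesis by (intro exI[of _ "max 0 M"]) auto
  qed
  define P where "P i s \<longleftrightarrow> (\<exists>g. uniform_limit (cball 0 (real i)) (\<lambda>n. f (s n)) g sequentially)"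
    for i and s :: "nat \<Rightarrow> nat"
  obtain r where r: "strict_mono (r :: nat \<Rightarrow> nat)" "\<And>i. P i (id \<circ> r)"
  proof (rule subsequence_diagonalization_lemma[of P id])
    fix i :: nat and s :: "nat \<Rightarrow> nat"
    obtain M where M: "\<And>n z. z \<in> cball 0 (real i) \<Longrightarrow> norm (f n z) \<le> M"
      using bounded by meson
    obtain L where L: "L \<ge> 0" "\<And>n x y. x \<in> cball 0 (real i) \<Longrightarrow> y \<in> cball 0 (real i) \<Longrightarrow>
        norm (f n x - f n y) \<le> L * norm (x - y)"
      using equicontinuous by meson
    obtain g k where k: "strict_mono (k :: nat \<Rightarrow> nat)"
      "\<And>e. 0 < e \<Longrightarrow> \<exists>N. \<forall>n x. n \<ge> N \<and> x \<in> cball 0 (real i) \<longrightarrow> norm (f (s (k n)) x - g x) < e"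
    proof (rule Arzela_Ascoli[of "cball 0 (real i)" "\<lambda>n. f (s n)" M])
      fix x e assume x: "x \<in> cball (0 :: complex^'k) (real i)" and e: "0 < (e :: real)"
      have "norm (f (s n) x - f (s n) y) < e"
        if "y \<in> cball 0 (real i)" "norm (x - y) < e / (L + 1)" for n y
      proof -
        have "norm (f (s n) x - f (s n) y) \<le> L * norm (x - y)" using L x that by blast
        also have "\<dots> \<le> (L + 1) * norm (x - y)" by (intro mult_right_mono) auto
        also have "\<dots> < e" using that(2) L(1) by (simp add: field_simps)
        finally show ?thesis .
      qed
      then show "\<exists>d>0. \<forall>n y. y \<in> cball 0 (real i) \<and> norm (x - y) < d \<longrightarrow>
          norm (f (s n) x - f (s n) y) < e"
        using e L(1) by (intro exI[of _ "e / (L + 1)"]) auto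
    qed (use M in auto)
    then have "P i (s \<circ> k)"
      unfolding P_def uniform_limit_sequentially_iff o_def dist_norm by metis
    then show "\<exists>k. strict_mono k \<and> P i (s \<circ> k)" using k(1) by blast
  next
    fix i N :: nat and s k1 k2 :: "nat \<Rightarrow> nat"
    assume 1: "P i (s \<circ> k1)" and 2: "\<And>j. N \<le> j \<Longrightarrow> \<exists>j'\<ge>j. k2 j = k1 j'"
    obtain g where g: "\<And>e. e > 0 \<Longrightarrow> \<exists>N. \<forall>x\<in>cball 0 (real i). \<forall>n\<ge>N. dist (f (s (k1 n)) x) (g x) < e"
      using 1 unfolding P_def uniform_limit_sequentially_iff o_def by blast
    have "\<exists>N. \<forall>x\<in>cball 0 (real i). \<forall>n\<ge>N. dist (f (s (k2 n)) x) (g x) < e" if "e > 0" for e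
    proof -
      obtain N' where N': "\<forall>x\<in>cball 0 (real i). \<forall>n\<ge>N'. dist (f (s (k1 n)) x) (g x) < e"
        using g[OF \<open>e > 0\<close>] by blast
      have "dist (f (s (k2 n)) x) (g x) < e" if x: "x \<in> cball 0 (real i)" "n \<ge> max N N'" for x n
      proof -
        obtain j' where "j' \<ge> n" "k2 n = k1 j'" using 2[of n] x by auto
        then show ?thesis using N' that by auto
      qed
      then show ?thesis by blast
    qed
    then show "P i (s \<circ> k2)"
      unfolding P_def uniform_limit_sequentially_iff o_def by blast
  qed auto
  define g where "g z = lim (\<lambda>n. f (r n) z)" for z
  have lim_nat: "uniform_limit (cball 0 (real i)) (\<lambda>n. f (r n)) g sequentially" for i
  proof -
    obtain h where h: "uniform_limit (cball 0 (real i)) (\<lambda>n. f (r n)) h sequentially"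
      using r(2)[of i] unfolding P_def by auto
    have "h z = g z" if "z \<in> cball 0 (real i)" for z
      unfolding g_def using limI[OF tendsto_uniform_limitI[OF h that]] by simp
    then show ?thesis
      using h uniform_limit_cong'[of "cball 0 (real i)" "\<lambda>n. f (r n)" "\<lambda>n. f (r n)" h g] by auto
  qed
  have lim: "uniform_limit (cball 0 R) (\<lambda>n. f (r n)) g sequentially" for R
  proof -
    obtain i :: nat where "R \<le> real i" using real_arch_simple by blast
    then show ?thesis
      by (intro uniform_limit_on_subset[OF lim_nat[of i]]) auto
  qed
  moreover have "entire g"
    by (rule entire_uniform_limit[OF _ lim]) (rule f)
  ultimately show ?thesis using that r(1) by blast
qed

section \<open>Conic neighbourhoods\<close>

lemma closed_pcone_zero:
  fixes U :: "(real^'k) set"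
  assumes "pcone U" "closed U"
  shows "0 \<in> U"
proof -
  obtain x where x: "x \<in> U" using assms by (auto simp: pcone_def)
  have "(\<lambda>n. inverse (real (Suc n)) *\<^sub>R x) \<longlonglongrightarrow> 0 *\<^sub>R x"
    by (intro tendsto_intros LIMSEQ_inverse_real_of_nat)
  moreover have "\<forall>n. inverse (real (Suc n)) *\<^sub>R x \<in> U"
    using x assms(1) by (simp add: pcone_def)
  ultimately show ?thesis
    using assms(2) by (auto simp: closed_sequential_limits)
qed

lemma pcone_Un: "pcone U \<Longrightarrow> pcone V \<Longrightarrow> pcone (U \<union> V)"
  by (auto simp: pcone_def)

lemma pcone_Int_closed:
  assumes "pcone U" "closed U" "pcone V" "closed V"
  shows "pcone (U \<inter> V)"
  using assms closed_pcone_zero[of U] closed_pcone_zero[of V] by (auto simp: pcone_def)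

lemma conic_nbhd_Un:
  assumes "conic_nbhd W U" "conic_nbhd W' U'"
  shows "conic_nbhd (W \<union> W') (U \<union> U')"
proof -
  have "sgn ` (W \<union> W' - {0}) = sgn ` (W - {0}) \<union> sgn ` (W' - {0})" by blast
  then show ?thesis
    using assms pcone_Un by (auto simp: conic_nbhd_def open_projection_def)
qed

text \<open>
  A countable base of the conic neighbourhoods of a closed cone. Listing the origin separately puts
  it into these sets without a hypothesis on \<open>U\<close>. For \<open>U = {0}\<close> they reduce to \<open>{0}\<close>, because the
  bound on the distance never exceeds \<open>1\<close>.
\<close>

definition nbhd_seq :: "(real^'k) set \<Rightarrow> nat \<Rightarrow> (real^'k) set" where
  "nbhd_seq U n = {x. x = 0 \<or> infdist (sgn x) U < 1 / (real n + 1)}"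

lemma sgn_scaleR_pos: "t > 0 \<Longrightarrow> sgn (t *\<^sub>R x) = sgn x" for x :: "real^'k"
  by (simp add: sgn_scaleR)

lemma nbhd_seq_antimono: "n \<le> m \<Longrightarrow> nbhd_seq U m \<subseteq> nbhd_seq U n"
proof
  fix x assume "n \<le> m" "x \<in> nbhd_seq U m"
  moreover have "1 / (real m + 1) \<le> 1 / (real n + 1)"
    using \<open>n \<le> m\<close> by (intro divide_left_mono) auto
  ultimately show "x \<in> nbhd_seq U n" by (auto simp: nbhd_seq_def)
qed

lemma zero_in_nbhd_seq [simp]: "0 \<in> nbhd_seq U n"
  by (simp add: nbhd_seq_def)

lemma pcone_nbhd_seq [simp]: "pcone (nbhd_seq U n)"
  unfolding pcone_def
proof (intro conjI ballI allI impI)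
  show "nbhd_seq U n \<noteq> {}" using zero_in_nbhd_seq by blast
qed (auto simp: nbhd_seq_def sgn_scaleR_pos)

lemma conic_nbhd_nbhd_seq:
  assumes "pcone U"
  shows "conic_nbhd (nbhd_seq U n) U"
proof -
  have "sgn ` (nbhd_seq U n - {0}) = sphere 0 1 \<inter> {s. infdist s U < 1 / (real n + 1)}"
  proof (intro equalityI subsetI)
    fix s assume s: "s \<in> sphere 0 1 \<inter> {s. infdist s U < 1 / (real n + 1)}"
    then have "s \<noteq> 0" "sgn s = s" by (auto simp: sgn_div_norm)
    then show "s \<in> sgn ` (nbhd_seq U n - {0})"
      using s by (intro image_eqI[of _ _ s]) (auto simp: nbhd_seq_def)
  qed (auto simp: nbhd_seq_def norm_sgn)
  moreover have "open {s. infdist s U < 1 / (real n + 1)}"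
    by (intro open_Collect_less continuous_intros)
  ultimately have "open_projection (nbhd_seq U n)"
    unfolding open_projection_def by (auto simp: openin_open)
  moreover have "U \<subseteq> nbhd_seq U n"
  proof
    fix x assume "x \<in> U"
    then have "sgn x \<in> U" if "x \<noteq> 0"
      using assms that by (auto simp: pcone_def sgn_div_norm)
    then show "x \<in> nbhd_seq U n"
      by (cases "x = 0") (auto simp: nbhd_seq_def)
  qed
  ultimately show ?thesis by (simp add: conic_nbhd_def)
qed

text \<open>
  The part of the unit sphere outside the projection of \<open>W\<close> is compact and disjoint from the closed
  set \<open>U\<close>, so it has a positive distance from \<open>U\<close>.
\<close>

lemma nbhd_seq_cofinal:
  assumes U: "pcone U" "closed U" and W: "conic_nbhd W U"
  shows "\<exists>n. nbhd_seq U n \<subseteq> W"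
proof -
  define Q where "Q = sphere 0 1 - sgn ` (W - {0})"
  have "pcone W" "U \<subseteq> W" and "openin (top_of_set (sphere 0 1)) (sgn ` (W - {0}))"
    using W by (auto simp: conic_nbhd_def open_projection_def)
  then have "closedin (top_of_set (sphere 0 1)) Q"
    unfolding Q_def by (metis closedin_diff closedin_topspace topspace_euclidean_subtopology)
  then have "compact Q"
    using closedin_compact compact_sphere by blast
  have pos: "infdist s U > 0" if "s \<in> Q" for s
  proof -
    have "s \<noteq> 0" "sgn s = s" using that by (auto simp: Q_def sgn_div_norm)
    then have "s \<notin> W" using that by (force simp: Q_def)
    then have "s \<notin> U" using \<open>U \<subseteq> W\<close> by blast
    then show ?thesis
      using U infdist_pos_not_in_closed by (auto simp: pcone_def)
  qed
  obtain d where d: "d > 0" "\<And>s. s \<in> Q \<Longrightarrow> d \<le> infdist s U"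
  proof (cases "Q = {}")
    case True
    then show ?thesis using that[of 1] by simp
  next
    case False
    have "continuous_on Q (\<lambda>s. infdist s U)" by (intro continuous_intros)
    then obtain s where "s \<in> Q" "\<And>t. t \<in> Q \<Longrightarrow> infdist s U \<le> infdist t U"
      using continuous_attains_inf[OF \<open>compact Q\<close> False] by blast
    then show ?thesis using that pos by blast
  qed
  obtain n where n: "1 / (real n + 1) < d"
    using reals_Archimedean[OF d(1)] by (auto simp: inverse_eq_divide add.commute)
  have "x \<in> W" if x: "x \<in> nbhd_seq U n" for x
  proof (cases "x = 0")
    case True
    then show ?thesis using closed_pcone_zero[OF U] \<open>U \<subseteq> W\<close> by blast
  next
    case False
    then have "sgn x \<notin> Q" using x n d(2)[of "sgn x"] by (auto simp: nbhd_seq_def)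
    then have "sgn x \<in> sgn ` (W - {0})" using False by (simp add: Q_def norm_sgn)
    then obtain y where y: "y \<in> W" "y \<noteq> 0" "sgn x = sgn y" by auto
    have "x = norm x *\<^sub>R sgn x" using False by (simp add: sgn_div_norm)
    also have "\<dots> = (norm x / norm y) *\<^sub>R y"
      unfolding y(3) by (simp add: sgn_div_norm divide_inverse)
    finally have "x = (norm x / norm y) *\<^sub>R y" .
    moreover have "norm x / norm y > 0" using False y by simp
    ultimately show ?thesis
      using \<open>pcone W\<close> y(1) unfolding pcone_def by metis
  qed
  then show ?thesis by blast
qed

section \<open>Growth functions and the compactness of the steps\<close>

lemma cone_dist_bdd: "bdd_below ((\<lambda>y. infnorm (x - y)) ` W)"
  by (rule bdd_belowI2[of _ 0]) (rule infnorm_pos_le)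

lemma cone_dist_le: "y \<in> W \<Longrightarrow> cone_dist W x \<le> infnorm (x - y)"
  unfolding cone_dist_def by (rule cINF_lower[OF cone_dist_bdd])

lemma cone_dist_nonneg: "W \<noteq> {} \<Longrightarrow> 0 \<le> cone_dist W x"
  unfolding cone_dist_def by (rule cINF_greatest) (auto simp: infnorm_pos_le)

lemma cone_dist_antimono:
  "W' \<subseteq> W \<Longrightarrow> W' \<noteq> {} \<Longrightarrow> cone_dist W x \<le> cone_dist W' x"
  unfolding cone_dist_def by (rule cINF_superset_mono[OF _ cone_dist_bdd]) auto

lemma cone_dist_Un:
  "W \<noteq> {} \<Longrightarrow> W' \<noteq> {} \<Longrightarrow> cone_dist (W \<union> W') x = min (cone_dist W x) (cone_dist W' x)"
  unfolding cone_dist_def using cINF_union[OF _ cone_dist_bdd _ cone_dist_bdd]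
  by (simp add: inf_min)

lemma cone_dist_scale_mono:
  assumes W: "pcone W" and B: "0 < B" "B \<le> B'"
  shows "cone_dist W (B *\<^sub>R x) \<le> cone_dist W (B' *\<^sub>R x)"
  unfolding cone_dist_def[of W "B' *\<^sub>R x"]
proof (rule cINF_greatest)
  show "W \<noteq> {}" using W by (simp add: pcone_def)
  fix y assume "y \<in> W"
  then have "(B / B') *\<^sub>R y \<in> W" using W B by (simp add: pcone_def)
  then have "cone_dist W (B *\<^sub>R x) \<le> infnorm (B *\<^sub>R x - (B / B') *\<^sub>R y)"
    by (rule cone_dist_le)
  also have "B *\<^sub>R x - (B / B') *\<^sub>R y = (B / B') *\<^sub>R (B' *\<^sub>R x - y)"
    using B by (simp add: scaleR_right_diff_distrib)
  also have "infnorm \<dots> = (B / B') * infnorm (B' *\<^sub>R x - y)"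
    using B by (simp add: infnorm_mul)
  also have "\<dots> \<le> 1 * infnorm (B' *\<^sub>R x - y)"
    using B by (intro mult_right_mono) (auto simp: infnorm_pos_le)
  finally show "cone_dist W (B *\<^sub>R x) \<le> infnorm (B' *\<^sub>R x - y)" by simp
qed

text \<open>
  The reciprocal of the weight: the norm of \<open>f\<close> in a step is the least \<open>C\<close> such that \<open>\<bar>f\<bar>\<close> is at
  most \<open>C\<close> times this function.
\<close>

definition growth :: "real \<Rightarrow> real \<Rightarrow> (real^'k) set \<Rightarrow> complex^'k::finite \<Rightarrow> real" where
  "growth A B W z = exp (cone_dist W (B *\<^sub>R re_part z) + infnorm (B *\<^sub>R im_part z)
                           - infnorm ((1 / A) *\<^sub>R re_part z))"

lemma growth_pos [simp]: "growth A B W z > 0" "growth A B W z \<ge> 0"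
  by (simp_all add: growth_def)

lemma weighted_le_iff: "weighted A B W f z \<le> C \<longleftrightarrow> norm (f z) \<le> C * growth A B W z"
proof -
  have "weighted A B W f z = norm (f z) / growth A B W z"
    by (simp add: weighted_def growth_def divide_inverse flip: exp_minus)
  then show ?thesis by (simp add: pos_divide_le_eq)
qed

lemma step_space_iff:
  "f \<in> step_space A B W \<longleftrightarrow> entire f \<and> (\<exists>C. \<forall>z. norm (f z) \<le> C * growth A B W z)"
  by (simp add: step_space_def bdd_above_def weighted_le_iff)

lemma step_norm_le: "(\<And>z. norm (f z) \<le> C * growth A B W z) \<Longrightarrow> step_norm A B W f \<le> C"
  unfolding step_norm_def by (rule cSUP_least) (auto simp: weighted_le_iff)

lemma norm_le_step_norm:
  assumes "f \<in> step_space A B W"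
  shows "norm (f z) \<le> step_norm A B W f * growth A B W z"
proof -
  have "weighted A B W f z \<le> step_norm A B W f"
    unfolding step_norm_def using assms by (intro cSUP_upper) (auto simp: step_space_def)
  then show ?thesis by (simp add: weighted_le_iff)
qed

lemma growth_mono:
  assumes "0 < A" "A \<le> A'" "0 < B" "B \<le> B'" "pcone W" "W' \<subseteq> W" "W' \<noteq> {}"
  shows "growth A B W z \<le> growth A' B' W' z"
proof -
  have "cone_dist W (B *\<^sub>R re_part z) \<le> cone_dist W' (B' *\<^sub>R re_part z)"
    using cone_dist_scale_mono[of W B B' "re_part z"] cone_dist_antimono[of W' W] assms
    by (meson order_trans)
  moreover have "infnorm (B *\<^sub>R im_part z) \<le> infnorm (B' *\<^sub>R im_part z)"
    using assms by (simp add: infnorm_mul mult_right_mono infnorm_pos_le)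
  moreover have "infnorm ((1 / A') *\<^sub>R re_part z) \<le> infnorm ((1 / A) *\<^sub>R re_part z)"
    using assms by (simp add: infnorm_mul frac_le infnorm_pos_le)
  ultimately show ?thesis by (simp add: growth_def)
qed

text \<open>
  As the distance to a union is the minimum of the distances, growth bounds for two cones combine to
  one for their union.
\<close>

lemma growth_Un:
  "W \<noteq> {} \<Longrightarrow> W' \<noteq> {} \<Longrightarrow> growth A B (W \<union> W') z = min (growth A B W z) (growth A B W' z)"
  by (simp add: growth_def cone_dist_Un min_def)

text \<open>
  Enlarging both \<open>A\<close> and \<open>B\<close> strictly gains exponential decay in all directions of the complex
  space: \<open>A\<close> accounts for the real directions and \<open>B\<close> for the imaginary ones.
\<close>

lemma growth_decay:
  assumes "0 < A" "A < A'" "0 < B" "B < B'" "pcone W"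
    and c: "c = min (1 / A - 1 / A') (B' - B)"
  shows "growth A B W z \<le>
    exp (- c * (infnorm (re_part z) + infnorm (im_part z))) * growth A' B' W z"
proof -
  have "cone_dist W (B *\<^sub>R re_part z) \<le> cone_dist W (B' *\<^sub>R re_part z)"
    using assms by (intro cone_dist_scale_mono) auto
  moreover have "c * infnorm (re_part z) \<le> (1 / A - 1 / A') * infnorm (re_part z)"
    using c by (intro mult_right_mono) (auto simp: infnorm_pos_le)
  moreover have "c * infnorm (im_part z) \<le> (B' - B) * infnorm (im_part z)"
    using c by (intro mult_right_mono) (auto simp: infnorm_pos_le)
  ultimately show ?thesis
    using assms by (simp add: growth_def infnorm_mul algebra_simps flip: exp_add)
qed

lemma infnorm_re_im_le: "infnorm (re_part z) \<le> norm z" "infnorm (im_part z) \<le> norm z"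
proof -
  have "norm (re_part z) \<le> norm z" "norm (im_part z) \<le> norm z"
    unfolding norm_vec_def re_part_def im_part_def
    by (auto intro!: L2_set_mono abs_Re_le_cmod abs_Im_le_cmod)
  then show "infnorm (re_part z) \<le> norm z" "infnorm (im_part z) \<le> norm z"
    using infnorm_le_norm order_trans by blast+
qed

lemma norm_le_infnorm_re_im:
  fixes z :: "complex^'k::finite"
  shows "norm z \<le> real CARD('k) * (infnorm (re_part z) + infnorm (im_part z))"
proof -
  have "norm z \<le> (\<Sum>j\<in>UNIV. norm (z $ j))"
    unfolding norm_vec_def by (rule L2_set_le_sum) simp
  also have "\<dots> \<le> (\<Sum>j\<in>(UNIV :: 'k set). infnorm (re_part z) + infnorm (im_part z))"
  proof (rule sum_mono)
    fix j
    have "norm (z $ j) \<le> \<bar>re_part z $ j\<bar> + \<bar>im_part z $ j\<bar>"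
      using cmod_le[of "z $ j"] by (simp add: re_part_def im_part_def)
    also have "\<dots> \<le> infnorm (re_part z) + infnorm (im_part z)"
      by (intro add_mono component_le_infnorm_cart)
    finally show "norm (z $ j) \<le> infnorm (re_part z) + infnorm (im_part z)" .
  qed
  finally show ?thesis by simp
qed

lemma growth_upper:
  assumes "0 < B" "0 \<in> W" "norm z \<le> R"
  shows "growth A B W z \<le> exp (2 * B * R)"
proof -
  have "cone_dist W (B *\<^sub>R re_part z) \<le> B * R"
    using cone_dist_le[OF assms(2), of "B *\<^sub>R re_part z"] infnorm_re_im_le(1)[of z] assms
    by (simp add: infnorm_mul) (smt (verit) mult_left_mono)
  moreover have "infnorm (B *\<^sub>R im_part z) \<le> B * R"
    using infnorm_re_im_le(2)[of z] assms by (simp add: infnorm_mul)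
  ultimately show ?thesis
    using infnorm_pos_le[of "(1 / A) *\<^sub>R re_part z"] by (simp add: growth_def)
qed

lemma growth_lower:
  assumes "0 < A" "W \<noteq> {}" "norm z \<le> R"
  shows "exp (- R / A) \<le> growth A B W z"
proof -
  have "infnorm ((1 / A) *\<^sub>R re_part z) \<le> R / A"
    using infnorm_re_im_le(1)[of z] assms by (simp add: infnorm_mul divide_right_mono)
  moreover have "0 \<le> cone_dist W (B *\<^sub>R re_part z)"
    by (rule cone_dist_nonneg[OF assms(2)])
  ultimately show ?thesis
    using infnorm_pos_le[of "B *\<^sub>R im_part z"] by (simp add: growth_def)
qed

text \<open>
  Montel's theorem gives locally uniform convergence. It becomes convergence in the larger step
  because outside a big ball all functions are uniformly negligible compared with the larger growth
  function (\<open>growth_decay\<close>), while inside the ball that function is bounded away from \<open>0\<close>.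
\<close>

lemma step_compact:
  fixes f :: "nat \<Rightarrow> 'k::finite testfun"
  assumes f: "\<And>m. entire (f m)" and bound: "\<And>m z. norm (f m z) \<le> C * growth A B W z"
    and "C \<ge> 0" and AB: "0 < A" "A < A'" "0 < B" "B < B'" and W: "pcone W" "0 \<in> W"
  obtains r g where "strict_mono (r :: nat \<Rightarrow> nat)" "entire g"
    "\<And>z. (\<lambda>m. f (r m) z) \<longlonglongrightarrow> g z"
    "\<And>e. e > 0 \<Longrightarrow> \<forall>\<^sub>F m in sequentially. \<forall>z. norm (f (r m) z - g z) \<le> e * growth A' B' W z"
proof -
  have "\<exists>M. \<forall>n. \<forall>z\<in>cball 0 R. norm (f n z) \<le> M" for R
  proof (intro exI allI ballI)
    fix n and z :: "complex^'k" assume "z \<in> cball 0 R"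
    then have "growth A B W z \<le> exp (2 * B * R)"
      using AB W by (intro growth_upper) auto
    then show "norm (f n z) \<le> C * exp (2 * B * R)"
      using bound[of n z] mult_left_mono[OF _ \<open>C \<ge> 0\<close>] order_trans by blast
  qed
  then obtain r g where r: "strict_mono (r :: nat \<Rightarrow> nat)" and g: "entire g"
    and unif: "\<And>R. uniform_limit (cball 0 R) (\<lambda>n. f (r n)) g sequentially"
    using entire_Montel[of f] f by blast
  have lim: "(\<lambda>m. f (r m) z) \<longlonglongrightarrow> g z" for z
    by (rule tendsto_uniform_limitI[OF unif[of "norm z"]]) simp
  have g_bound: "norm (g z) \<le> C * growth A B W z" for z
    by (rule Lim_norm_ubound[OF _ lim]) (use bound in auto)
  have "\<forall>\<^sub>F m in sequentially. \<forall>z. norm (f (r m) z - g z) \<le> e * growth A' B' W z" if e: "e > 0" for e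
  proof -
    define c where "c = min (1 / A - 1 / A') (B' - B)"
    have c: "c > 0" using AB by (simp add: c_def field_simps)
    define k where "k = real CARD('k)"
    have k: "k > 0" by (simp add: k_def)
    \<comment> \<open>The radius is chosen so that \<open>exp y \<ge> 1 + y\<close> with \<open>y = 2 * C / e\<close> makes the tail smaller than \<open>e\<close>.\<close>
    define R where "R = k / c * (2 * C / e)"
    have R: "2 * C * exp (- c * (R / k)) < e"
    proof -
      have "1 + 2 * C / e \<le> exp (2 * C / e)"
        by (rule exp_ge_add_one_self)
      then have "2 * C < e * exp (2 * C / e)"
        using e by (simp add: field_simps)
      moreover have "c * (R / k) = 2 * C / e"
        using c k by (simp add: R_def)
      ultimately show ?thesis by (simp add: exp_minus field_simps)
    qed
    have "\<forall>\<^sub>F m in sequentially. \<forall>z\<in>cball 0 R. dist (f (r m) z) (g z) < e * exp (- R / A')"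
      using unif[of R] e unfolding uniform_limit_iff by simp
    then show ?thesis
    proof (rule eventually_mono, intro allI)
      fix m z assume close: "\<forall>z\<in>cball 0 R. dist (f (r m) z) (g z) < e * exp (- R / A')"
      show "norm (f (r m) z - g z) \<le> e * growth A' B' W z"
      proof (cases "norm z \<le> R")
        case True
        then have "norm (f (r m) z - g z) \<le> e * exp (- R / A')"
          using close by (force simp: dist_norm)
        also have "\<dots> \<le> e * growth A' B' W z"
          using True AB W e growth_lower[of A' W z R B'] by (intro mult_left_mono) auto
        finally show ?thesis .
      next
        case False
        have far: "R / k \<le> infnorm (re_part z) + infnorm (im_part z)"
          using norm_le_infnorm_re_im[of z] False k by (simp add: k_def field_simps)
        then have decay: "exp (- c * (infnorm (re_part z) + infnorm (im_part z))) \<le> exp (- c * (R / k))"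
          using mult_left_mono[OF far, of c] c by simp
        have "norm (f (r m) z - g z) \<le> 2 * C * growth A B W z"
          using norm_triangle_ineq4[of "f (r m) z" "g z"] bound[of "r m" z] g_bound[of z] by simp
        also have "\<dots> \<le> 2 * C * (exp (- c * (R / k)) * growth A' B' W z)"
          using growth_decay[OF AB W(1) c_def, of z] decay \<open>C \<ge> 0\<close>
          by (intro mult_left_mono order_trans[OF growth_decay[OF AB W(1) c_def]] mult_right_mono) auto
        also have "\<dots> = (2 * C * exp (- c * (R / k))) * growth A' B' W z" by simp
        also have "\<dots> \<le> e * growth A' B' W z"
          using R by (intro mult_right_mono) auto
        finally show ?thesis .
      qed
    qed
  qed
  with r g lim that show ?thesis by blast
qed

section \<open>Cofinal steps and continuity of functionals\<close>

text \<open>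
  A single sequence of steps, cofinal among all parameters \<open>A\<close>, \<open>B\<close>, \<open>W\<close> by
  \<open>growth_le_stage_growth\<close>. The shift by one keeps \<open>A\<close> and \<open>B\<close> positive for \<open>n = 0\<close>.
\<close>

definition stage_growth :: "(real^'k) set \<Rightarrow> nat \<Rightarrow> complex^'k::finite \<Rightarrow> real" where
  "stage_growth U n = growth (real n + 1) (real n + 1) (nbhd_seq U n)"

lemma stage_growth_pos [simp]: "stage_growth U n z > 0" "stage_growth U n z \<ge> 0"
  by (simp_all add: stage_growth_def)

lemma nbhd_seq_nonempty [simp]: "nbhd_seq U n \<noteq> {}"
  using zero_in_nbhd_seq by blast

lemma stage_growth_mono: "n \<le> m \<Longrightarrow> stage_growth U n z \<le> stage_growth U m z"
  unfolding stage_growth_def by (rule growth_mono) (use nbhd_seq_antimono[of n m U] in auto)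

lemma growth_le_stage_growth:
  assumes U: "pcone U" "closed U" and W: "conic_nbhd W U" and AB: "0 < A" "0 < B"
  shows "\<exists>n. \<forall>z. growth A B W z \<le> stage_growth U n z"
proof -
  obtain n1 where n1: "nbhd_seq U n1 \<subseteq> W" using nbhd_seq_cofinal[OF U W] by blast
  obtain n2 :: nat where n2: "max A B \<le> real n2" using real_arch_simple by blast
  define n where "n = max n1 n2"
  have "nbhd_seq U n \<subseteq> W"
    using n1 nbhd_seq_antimono[of n1 n U] by (auto simp: n_def)
  moreover have "A \<le> real n + 1" "B \<le> real n + 1" using n2 by (auto simp: n_def)
  ultimately have "growth A B W z \<le> stage_growth U n z" for z
    unfolding stage_growth_def using AB W by (intro growth_mono) (auto simp: conic_nbhd_def)
  then show ?thesis by blast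
qed

lemma test_space_iff:
  assumes "pcone U" "closed U"
  shows "f \<in> test_space U \<longleftrightarrow> entire f \<and> (\<exists>n. \<exists>C>0. \<forall>z. norm (f z) \<le> C * stage_growth U n z)"
proof
  assume "f \<in> test_space U"
  then obtain A B W where ABW: "0 < A" "0 < B" "conic_nbhd W U" and f: "f \<in> step_space A B W"
    by (auto simp: test_space_def)
  obtain n where n: "\<And>z. growth A B W z \<le> stage_growth U n z"
    using growth_le_stage_growth[OF assms ABW(3,1,2)] by blast
  obtain C where C: "\<And>z. norm (f z) \<le> C * growth A B W z" "entire f"
    using f by (auto simp: step_space_iff)
  have "norm (f z) \<le> max 1 C * stage_growth U n z" for z
  proof -
    have "norm (f z) \<le> max 1 C * growth A B W z"
      using C(1)[of z] mult_right_mono[of C "max 1 C" "growth A B W z"] by (simp add: order_trans)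
    also have "\<dots> \<le> max 1 C * stage_growth U n z"
      using n by (intro mult_left_mono) auto
    finally show ?thesis .
  qed
  then show "entire f \<and> (\<exists>n. \<exists>C>0. \<forall>z. norm (f z) \<le> C * stage_growth U n z)"
    using C(2) by (metis less_max_iff_disj zero_less_one)
next
  assume "entire f \<and> (\<exists>n. \<exists>C>0. \<forall>z. norm (f z) \<le> C * stage_growth U n z)"
  then obtain n where "f \<in> step_space (real n + 1) (real n + 1) (nbhd_seq U n)"
    by (auto simp: step_space_iff stage_growth_def)
  moreover have "conic_nbhd (nbhd_seq U n) U" "real n + 1 > 0"
    using conic_nbhd_nbhd_seq assms by auto
  ultimately show "f \<in> test_space U"
    unfolding test_space_def by blast
qed

lemma test_space_antimono: "U' \<subseteq> U \<Longrightarrow> test_space U \<subseteq> test_space U'"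
  unfolding test_space_def conic_nbhd_def by blast

lemma test_space_lincomb:
  assumes U: "pcone U" "closed U" and fg: "f \<in> test_space U" "g \<in> test_space U"
  shows "(\<lambda>z. a * f z + b * g z) \<in> test_space U"
proof -
  obtain n1 C1 where 1: "entire f" "C1 > 0" "\<And>z. norm (f z) \<le> C1 * stage_growth U n1 z"
    using fg(1) test_space_iff[OF U] by metis
  obtain n2 C2 where 2: "entire g" "C2 > 0" "\<And>z. norm (g z) \<le> C2 * stage_growth U n2 z"
    using fg(2) test_space_iff[OF U] by metis
  define n where "n = max n1 n2"
  define C where "C = norm a * C1 + norm b * C2 + 1"
  have "norm (a * f z + b * g z) \<le> C * stage_growth U n z" for z
  proof -
    have "norm (f z) \<le> C1 * stage_growth U n z"
      using 1(2) 1(3)[of z] mult_left_mono[OF stage_growth_mono[of n1 n U z], of C1]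
      by (auto simp: n_def intro: order_trans)
    moreover have "norm (g z) \<le> C2 * stage_growth U n z"
      using 2(2) 2(3)[of z] mult_left_mono[OF stage_growth_mono[of n2 n U z], of C2]
      by (auto simp: n_def intro: order_trans)
    ultimately have "norm a * norm (f z) + norm b * norm (g z) \<le>
        norm a * (C1 * stage_growth U n z) + norm b * (C2 * stage_growth U n z)"
      by (intro add_mono mult_left_mono) auto
    also have "\<dots> \<le> C * stage_growth U n z"
      by (simp add: C_def algebra_simps)
    finally show ?thesis
      using norm_triangle_ineq[of "a * f z" "b * g z"] by (simp add: norm_mult)
  qed
  moreover have "C > 0" unfolding C_def using 1 2 by (simp add: add_nonneg_pos)
  ultimately show ?thesis
    using entire_lincomb[OF 1(1) 2(1)] test_space_iff[OF U] by blast
qed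

lemma test_space_zero:
  assumes "pcone U" "closed U"
  shows "(\<lambda>z. 0) \<in> test_space U"
proof -
  have "entire (\<lambda>z. 0)" unfolding entire_def by (intro allI exI[of _ "\<lambda>z. 0"]) auto
  moreover have "norm (0 :: complex) \<le> 1 * stage_growth U 0 z" for z by simp
  ultimately show ?thesis
    using test_space_iff[OF assms] by (metis zero_less_one)
qed

lemma test_space_add:
  assumes "pcone U" "closed U" "f \<in> test_space U" "g \<in> test_space U"
  shows "f + g \<in> test_space U"
  using test_space_lincomb[OF assms, of 1 1] by (simp add: plus_fun_def)

lemma test_space_scale:
  assumes "pcone U" "closed U" "f \<in> test_space U"
  shows "(\<lambda>z. c * f z) \<in> test_space U"
  using test_space_lincomb[OF assms assms(3), of c 0] by simp

text \<open>
  The whole test space is one of the basic neighbourhoods of \<open>0\<close>; it is absolutely convex because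
  the steps of the cofinal sequence are nested.
\<close>

lemma topspace_test_topology:
  assumes "pcone U" "closed U"
  shows "topspace (test_topology U) = test_space U"
proof
  show "topspace (test_topology U) \<subseteq> test_space U"
    using openin_topspace openin_test_topology by blast
  have step: "step_space A B W \<subseteq> test_space U" if "0 < A" "0 < B" "conic_nbhd W U" for A B W
    using that unfolding test_space_def by blast
  have "zero_nbhd U (test_space U)"
    unfolding zero_nbhd_def abs_convex_def
  proof (intro conjI ballI allI impI)
    fix A B :: real and W assume "0 < A" "0 < B" "conic_nbhd W U"
    then show "\<exists>e>0. {f \<in> step_space A B W. step_norm A B W f < e} \<subseteq> test_space U"
      using step[of A B W] by (intro exI[of _ 1]) auto
  qed (use test_space_lincomb[OF assms] in auto)
  then have "openin (test_topology U) (test_space U)"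
    unfolding openin_test_topology
    using test_space_add[OF assms] by (auto simp: elt_set_plus_def)
  then show "test_space U \<subseteq> topspace (test_topology U)"
    by (rule openin_subset)
qed

lemma dual_space_add:
  "u \<in> dual_space U \<Longrightarrow> f \<in> test_space U \<Longrightarrow> g \<in> test_space U \<Longrightarrow> u (f + g) = u f + u g"
  by (simp add: dual_space_def)

lemma dual_space_scale:
  "u \<in> dual_space U \<Longrightarrow> f \<in> test_space U \<Longrightarrow> u (\<lambda>z. c * f z) = c * u f"
  by (simp add: dual_space_def)

lemma dual_space_outside: "u \<in> dual_space U \<Longrightarrow> f \<notin> test_space U \<Longrightarrow> u f = 0"
  by (simp add: dual_space_def)

text \<open>
  Convergence in the norm of a single step implies convergence in the inductive limit.
\<close>

lemma dual_space_sequentially: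
  assumes U: "pcone U" "closed U" and u: "u \<in> dual_space U"
    and W: "conic_nbhd W U" and AB: "0 < A" "0 < B"
    and g: "g \<in> test_space U" and f: "\<And>m. entire (f m)"
    and conv: "\<And>e. e > 0 \<Longrightarrow>
      \<forall>\<^sub>F m in sequentially. \<forall>z. norm (f m z - g z) \<le> e * growth A B W z"
  shows "(\<lambda>m. u (f m)) \<longlonglongrightarrow> u g"
proof (rule tendstoI)
  fix e :: real assume "e > 0"
  define X where "X = {h \<in> topspace (test_topology U). u h \<in> ball (u g) e}"
  have "openin (test_topology U) X"
    using u unfolding dual_space_def X_def continuous_map_def by auto
  moreover have "g \<in> X"
    using g \<open>e > 0\<close> by (simp add: X_def topspace_test_topology[OF U])
  ultimately obtain V where V: "zero_nbhd U V" "g +o V \<subseteq> X"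
    unfolding openin_test_topology by blast
  then obtain d where d: "d > 0" "{h \<in> step_space A B W. step_norm A B W h < d} \<subseteq> V"
    using W AB unfolding zero_nbhd_def by blast
  have "entire g" using g test_space_iff[OF U] by blast
  show "\<forall>\<^sub>F m in sequentially. dist (u (f m)) (u g) < e"
  proof (rule eventually_mono[OF conv[of "d / 2"]])
    fix m assume m: "\<forall>z. norm (f m z - g z) \<le> d / 2 * growth A B W z"
    define h where "h = (\<lambda>z. f m z - g z)"
    have "h \<in> step_space A B W"
      unfolding step_space_iff h_def using m entire_diff[OF f \<open>entire g\<close>] by blast
    moreover have "step_norm A B W h < d"
      using step_norm_le[of h "d / 2" A B W] m d(1) by (simp add: h_def)
    ultimately have "h \<in> V" using d(2) by blast
    then have "g + h \<in> X" using V(2) by (auto simp: elt_set_plus_def)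
    moreover have "g + h = f m" by (auto simp: h_def fun_eq_iff)
    ultimately show "dist (u (f m)) (u g) < e"
      by (simp add: X_def dist_commute)
  qed (use d in simp)
qed

text \<open>
  A linear functional on an inductive limit is continuous once it is bounded on each step: then the
  sets \<open>\<bar>L f\<bar> < r\<close> are basic neighbourhoods of \<open>0\<close>. Only the steps of the cofinal sequence matter.
\<close>

lemma dual_spaceI:
  assumes U: "pcone U" "closed U"
    and add: "\<And>f g. f \<in> test_space U \<Longrightarrow> g \<in> test_space U \<Longrightarrow> L (f + g) = L f + L g"
    and scale: "\<And>c f. f \<in> test_space U \<Longrightarrow> L (\<lambda>z. c * f z) = c * L f"
    and out: "\<And>f. f \<notin> test_space U \<Longrightarrow> L f = 0"
    and bound: "\<And>n. \<exists>C. \<forall>f N. entire f \<longrightarrow> N > 0 \<longrightarrow> (\<forall>z. norm (f z) \<le> N * stage_growth U n z) \<longrightarrow>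
                  norm (L f) \<le> C * N"
  shows "L \<in> dual_space U"
proof -
  have nbhd: "zero_nbhd U {f \<in> test_space U. norm (L f) < r}" if r: "r > 0" for r
    unfolding zero_nbhd_def abs_convex_def
  proof (intro conjI ballI allI impI)
    fix f g and a b :: complex
    assume f: "f \<in> {f \<in> test_space U. norm (L f) < r}" and g: "g \<in> {f \<in> test_space U. norm (L f) < r}"
      and ab: "norm a + norm b \<le> 1"
    have mem: "(\<lambda>z. a * f z) \<in> test_space U" "(\<lambda>z. b * g z) \<in> test_space U"
      "(\<lambda>z. a * f z + b * g z) \<in> test_space U"
      using f g test_space_scale[OF U] test_space_lincomb[OF U] by auto
    have "L (\<lambda>z. a * f z + b * g z) = a * L f + b * L g"
      using add[OF mem(1,2)] scale f g by (simp add: plus_fun_def)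
    moreover have "norm (a * L f + b * L g) < r"
    proof -
      define q where "q = max (norm (L f)) (norm (L g))"
      have "q < r" "q \<ge> 0" using f g by (auto simp: q_def max_def)
      have "norm (a * L f + b * L g) \<le> norm a * norm (L f) + norm b * norm (L g)"
        using norm_triangle_ineq[of "a * L f" "b * L g"] by (simp add: norm_mult)
      also have "\<dots> \<le> norm a * q + norm b * q"
        by (intro add_mono mult_left_mono) (auto simp: q_def)
      also have "\<dots> = (norm a + norm b) * q" by (simp add: algebra_simps)
      also have "\<dots> \<le> 1 * q" using ab \<open>q \<ge> 0\<close> by (intro mult_right_mono) auto
      finally show ?thesis using \<open>q < r\<close> by simp
    qed
    ultimately show "(\<lambda>z. a * f z + b * g z) \<in> {f \<in> test_space U. norm (L f) < r}"
      using mem by simp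
  next
    fix A B :: real and W assume AB: "0 < A" "0 < B" and W: "conic_nbhd W U"
    obtain n where n: "\<And>z. growth A B W z \<le> stage_growth U n z"
      using growth_le_stage_growth[OF U W AB] by blast
    obtain C where C: "\<And>f N. entire f \<Longrightarrow> N > 0 \<Longrightarrow> (\<And>z. norm (f z) \<le> N * stage_growth U n z) \<Longrightarrow>
                  norm (L f) \<le> C * N"
      using bound[of n] by blast
    define e where "e = r / (\<bar>C\<bar> + 1)"
    have e: "e > 0" using r by (simp add: e_def add_nonneg_pos)
    have "f \<in> test_space U \<and> norm (L f) < r"
      if f: "f \<in> step_space A B W" "step_norm A B W f < e" for f
    proof
      show "f \<in> test_space U" using f AB W unfolding test_space_def by blast
      have "norm (f z) \<le> e * stage_growth U n z" for z
      proof -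
        have "norm (f z) \<le> step_norm A B W f * growth A B W z"
          by (rule norm_le_step_norm[OF f(1)])
        also have "\<dots> \<le> e * growth A B W z" using f(2) by (intro mult_right_mono) auto
        also have "\<dots> \<le> e * stage_growth U n z" using n e by (intro mult_left_mono) auto
        finally show ?thesis .
      qed
      moreover have "entire f" using f by (simp add: step_space_iff)
      ultimately have "norm (L f) \<le> C * e" using C e by blast
      also have "\<dots> < (\<bar>C\<bar> + 1) * e" using e by (intro mult_strict_right_mono) auto
      also have "\<dots> = r" by (simp add: e_def)
      finally show "norm (L f) < r" .
    qed
    then show "\<exists>e>0. {f \<in> step_space A B W. step_norm A B W f < e} \<subseteq> {f \<in> test_space U. norm (L f) < r}"
      using e by (intro exI[of _ e]) auto
  qed auto
  have "continuous_map (test_topology U) euclidean L"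
    unfolding continuous_map_def
  proof (intro conjI allI impI)
    fix S :: "complex set" assume "openin euclidean S"
    then have S: "open S" by simp
    show "openin (test_topology U) {f \<in> topspace (test_topology U). L f \<in> S}"
      unfolding openin_test_topology topspace_test_topology[OF U]
    proof (intro conjI ballI)
      fix f assume f: "f \<in> {f \<in> test_space U. L f \<in> S}"
      then obtain r where r: "r > 0" "ball (L f) r \<subseteq> S" using S open_contains_ball by blast
      have "f + h \<in> {f \<in> test_space U. L f \<in> S}" if "h \<in> test_space U" "norm (L h) < r" for h
        using that f r(2) add[of f h] test_space_add[OF U, of f h] by (auto simp: dist_norm)
      then show "\<exists>V. zero_nbhd U V \<and> f +o V \<subseteq> {f \<in> test_space U. L f \<in> S}"
        using nbhd[OF r(1)]
        by (intro exI[of _ "{f \<in> test_space U. norm (L f) < r}"]) (auto simp: elt_set_plus_def)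
    qed auto
  qed auto
  then show ?thesis
    unfolding dual_space_def using add scale out by blast
qed

section \<open>Simultaneously small bounds\<close>

text \<open>
  If no \<open>e\<close> works, there are functions \<open>f m\<close> with \<open>\<bar>u (f m)\<bar> \<ge> 1\<close> obeying the bounds enlarged by
  \<open>1 / (m + 1)\<close> times the growth functions. They are bounded in a step for the union, so a
  subsequence converges in a larger step, where \<open>u\<close> is continuous. The limit obeys the original
  bounds \<open>b1\<close> and \<open>b2\<close> and still satisfies \<open>\<bar>u g\<bar> \<ge> 1\<close>, a contradiction.
\<close>

lemma small_bound_step:
  fixes U1 U2 :: "(real^'k) set" and b1 b2 :: "complex^'k \<Rightarrow> real"
  assumes U: "pcone U1" "closed U1" "pcone U2" "closed U2"
    and u: "u \<in> dual_space (U1 \<union> U2)"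
    and b1: "\<And>z. b1 z \<le> C * stage_growth U1 n z" and b2: "\<And>z. b2 z \<le> C * stage_growth U2 n z"
    and "C \<ge> 0"
    and small: "\<And>f. entire f \<Longrightarrow> (\<And>z. norm (f z) \<le> b1 z) \<Longrightarrow> (\<And>z. norm (f z) \<le> b2 z) \<Longrightarrow>
        norm (u f) < 1"
  shows "\<exists>e>0. \<forall>f. entire f \<longrightarrow> (\<forall>z. norm (f z) \<le> b1 z + e * stage_growth U1 n z) \<longrightarrow>
      (\<forall>z. norm (f z) \<le> b2 z + e * stage_growth U2 n z) \<longrightarrow> norm (u f) < 1"
proof (rule ccontr)
  assume contra: "\<not> ?thesis"
  define \<epsilon> where "\<epsilon> m = inverse (real (Suc m))" for m
  have \<epsilon>: "\<epsilon> m > 0" "\<epsilon> m \<le> 1" for m by (auto simp: \<epsilon>_def field_simps)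
  have "\<forall>m. \<exists>f. entire f \<and> (\<forall>z. norm (f z) \<le> b1 z + \<epsilon> m * stage_growth U1 n z) \<and>
      (\<forall>z. norm (f z) \<le> b2 z + \<epsilon> m * stage_growth U2 n z) \<and> \<not> norm (u f) < 1"
    using contra \<epsilon>(1) by blast
  then obtain f where f: "\<And>m. entire (f m)"
    and f1: "\<And>m z. norm (f m z) \<le> b1 z + \<epsilon> m * stage_growth U1 n z"
    and f2: "\<And>m z. norm (f m z) \<le> b2 z + \<epsilon> m * stage_growth U2 n z"
    and big: "\<And>m. norm (u (f m)) \<ge> 1"
    by (metis not_less)
  define W where "W = nbhd_seq U1 n \<union> nbhd_seq U2 n"
  define A where "A = real n + 1"
  have W: "pcone W" "0 \<in> W" "conic_nbhd W (U1 \<union> U2)"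
    using conic_nbhd_Un[OF conic_nbhd_nbhd_seq conic_nbhd_nbhd_seq, of U1 U2 n n] U
    by (auto simp: W_def conic_nbhd_def)
  have UU: "pcone (U1 \<union> U2)" "closed (U1 \<union> U2)" using U pcone_Un by auto
  have min: "growth A A W z = min (stage_growth U1 n z) (stage_growth U2 n z)" for z
    by (simp add: W_def growth_Un stage_growth_def A_def)
  have bound: "norm (f m z) \<le> (C + 1) * growth A A W z" for m z
  proof -
    have "\<epsilon> m * stage_growth U1 n z \<le> 1 * stage_growth U1 n z"
      "\<epsilon> m * stage_growth U2 n z \<le> 1 * stage_growth U2 n z"
      using \<epsilon>(2)[of m] by (auto intro!: mult_right_mono)
    then have "norm (f m z) \<le> (C + 1) * stage_growth U1 n z" "norm (f m z) \<le> (C + 1) * stage_growth U2 n z"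
      using f1[of m z] f2[of m z] b1[of z] b2[of z] unfolding distrib_right by linarith+
    then show ?thesis by (simp add: min min_def)
  qed
  have pos: "C + 1 \<ge> 0" "0 < A" "A < A + 1" using \<open>C \<ge> 0\<close> by (auto simp: A_def)
  obtain r g where r: "strict_mono (r :: nat \<Rightarrow> nat)" and g: "entire g"
    and lim: "\<And>z. (\<lambda>m. f (r m) z) \<longlonglongrightarrow> g z"
    and conv: "\<And>e. e > 0 \<Longrightarrow> \<forall>\<^sub>F m in sequentially. \<forall>z. norm (f (r m) z - g z) \<le> e * growth (A + 1) (A + 1) W z"
    by (rule step_compact[where f = f and C = "C + 1" and A = A and B = A and A' = "A + 1"
          and B' = "A + 1" and W = W]) (assumption | rule f bound pos W that)+
  have "(\<lambda>m. \<epsilon> (r m)) \<longlonglongrightarrow> 0"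
    using LIMSEQ_subseq_LIMSEQ[OF LIMSEQ_inverse_real_of_nat r] by (simp add: \<epsilon>_def o_def)
  then have "(\<lambda>m. b z + \<epsilon> (r m) * s) \<longlonglongrightarrow> b z + 0 * s" for b :: "complex^'k \<Rightarrow> real" and z s
    by (intro tendsto_intros)
  then have b_lim: "(\<lambda>m. b z + \<epsilon> (r m) * s) \<longlonglongrightarrow> b z" for b :: "complex^'k \<Rightarrow> real" and z s
    by simp
  have g1: "norm (g z) \<le> b1 z" for z
    by (rule LIMSEQ_le[OF tendsto_norm[OF lim] b_lim[of b1 z "stage_growth U1 n z"]]) (use f1 in auto)
  have g2: "norm (g z) \<le> b2 z" for z
    by (rule LIMSEQ_le[OF tendsto_norm[OF lim] b_lim[of b2 z "stage_growth U2 n z"]]) (use f2 in auto)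
  have "norm (g z) \<le> C * growth A A W z" for z
    using order_trans[OF g1 b1, of z] order_trans[OF g2 b2, of z] by (simp add: min min_def)
  then have "g \<in> step_space A A W" using g by (auto simp: step_space_iff)
  moreover have "A > 0" by (simp add: A_def)
  ultimately have "g \<in> test_space (U1 \<union> U2)"
    using W(3) unfolding test_space_def by blast
  then have "(\<lambda>m. u (f (r m))) \<longlonglongrightarrow> u g"
    using \<open>A > 0\<close> by (intro dual_space_sequentially[OF UU u W(3) _ _ _ f conv]) auto
  then have "1 \<le> norm (u g)"
    using big by (intro LIMSEQ_le_const[OF tendsto_norm]) auto
  with small[OF g g1 g2] show False by simp
qed

text \<open>
  The \<open>n\<close>-th bounds are obtained from the previous ones by adding a small multiple of the \<open>n\<close>-th
  growth functions. Since they dominate such a multiple, the functions below some \<open>b1 n\<close> contain a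
  ball of every step for \<open>U1\<close>, and likewise for \<open>U2\<close>.
\<close>

lemma small_bounds_exist:
  fixes U1 U2 :: "(real^'k) set"
  assumes U: "pcone U1" "closed U1" "pcone U2" "closed U2"
    and u: "u \<in> dual_space (U1 \<union> U2)"
  obtains b1 b2 :: "nat \<Rightarrow> complex^'k \<Rightarrow> real"
  where "incseq b1" "incseq b2"
    "\<And>n. \<exists>e>0. \<forall>z. e * stage_growth U1 n z \<le> b1 n z"
    "\<And>n. \<exists>e>0. \<forall>z. e * stage_growth U2 n z \<le> b2 n z"
    "\<And>n. \<exists>C\<ge>0. \<forall>z. b1 n z \<le> C * stage_growth U1 n z"
    "\<And>n. \<exists>C\<ge>0. \<forall>z. b2 n z \<le> C * stage_growth U2 n z"
    "\<And>n f. entire f \<Longrightarrow> (\<And>z. norm (f z) \<le> b1 n z) \<Longrightarrow> (\<And>z. norm (f z) \<le> b2 n z) \<Longrightarrow>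
       norm (u f) < 1"
proof -
  define small where "small p \<longleftrightarrow> (\<forall>f. entire f \<longrightarrow> (\<forall>z. norm (f z) \<le> fst p z) \<longrightarrow>
      (\<forall>z. norm (f z) \<le> snd p z) \<longrightarrow> norm (u f) < 1)"
    for p :: "(complex^'k \<Rightarrow> real) \<times> (complex^'k \<Rightarrow> real)"
  define upper where "upper n p \<longleftrightarrow>
      (\<exists>C\<ge>0. \<forall>z. fst p z \<le> C * stage_growth U1 n z \<and> snd p z \<le> C * stage_growth U2 n z)"
    for n and p :: "(complex^'k \<Rightarrow> real) \<times> (complex^'k \<Rightarrow> real)"
  define lower where "lower n p \<longleftrightarrow>
      (\<exists>e>0. \<forall>z. e * stage_growth U1 n z \<le> fst p z \<and> e * stage_growth U2 n z \<le> snd p z)"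
    for n and p :: "(complex^'k \<Rightarrow> real) \<times> (complex^'k \<Rightarrow> real)"
  have enlarge: "\<exists>q. (small q \<and> upper n q \<and> lower n q) \<and> p \<le> q"
    if p: "small p" "upper n p" and nonneg: "\<And>z. 0 \<le> fst p z" "\<And>z. 0 \<le> snd p z" for n p
  proof -
    obtain C where C: "C \<ge> 0" "\<And>z. fst p z \<le> C * stage_growth U1 n z"
      "\<And>z. snd p z \<le> C * stage_growth U2 n z"
      using p by (auto simp: upper_def)
    obtain e where e: "e > 0" and e_small: "\<forall>f. entire f \<longrightarrow>
        (\<forall>z. norm (f z) \<le> fst p z + e * stage_growth U1 n z) \<longrightarrow>
        (\<forall>z. norm (f z) \<le> snd p z + e * stage_growth U2 n z) \<longrightarrow> norm (u f) < 1"
      using small_bound_step[OF U u C(2,3,1)] p(1) unfolding small_def by blast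
    define q where "q = (\<lambda>z. fst p z + e * stage_growth U1 n z, \<lambda>z. snd p z + e * stage_growth U2 n z)"
    have "small q" using e_small by (simp add: small_def q_def)
    moreover have "upper n q"
      unfolding upper_def q_def using C e by (intro exI[of _ "C + e"]) (auto simp: algebra_simps)
    moreover have "lower n q"
      unfolding lower_def q_def using nonneg e by (intro exI[of _ e]) auto
    moreover have "p \<le> q"
      using e by (auto simp: q_def less_eq_prod_def le_fun_def)
    ultimately show ?thesis by blast
  qed
  have nonneg: "0 \<le> fst p z" "0 \<le> snd p z" if "lower n p" for n p z
    using that unfolding lower_def by (meson mult_nonneg_nonneg less_imp_le order_trans stage_growth_pos)+
  have UU: "pcone (U1 \<union> U2)" "closed (U1 \<union> U2)" using U pcone_Un by auto
  have u0: "u (\<lambda>z. 0) = 0"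
    using dual_space_scale[OF u test_space_zero[OF UU], of 0] by simp
  have "\<exists>s. \<forall>n. (small (s n) \<and> upper n (s n) \<and> lower n (s n)) \<and> s n \<le> s (Suc n)"
  proof (rule dependent_nat_choice)
    \<comment> \<open>The recursion starts from the bound 0, below which there is only the zero function.\<close>
    have "small (\<lambda>z. 0, \<lambda>z. 0)"
    proof -
      have "f = (\<lambda>z. 0)" if "\<forall>z. norm (f z) \<le> 0" for f :: "'k testfun"
        using that by auto
      then show ?thesis unfolding small_def using u0 by (metis fst_conv norm_zero zero_less_one)
    qed
    moreover have "upper 0 (\<lambda>z. 0, \<lambda>z. 0)"
      unfolding upper_def by (intro exI[of _ 0]) auto
    ultimately show "\<exists>q. small q \<and> upper 0 q \<and> lower 0 q"
      using enlarge[of "(\<lambda>z. 0, \<lambda>z. 0)" 0] by auto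
  next
    fix p n assume p: "small p \<and> upper n p \<and> lower n p"
    then obtain C where C: "C \<ge> 0" "\<And>z. fst p z \<le> C * stage_growth U1 n z"
      "\<And>z. snd p z \<le> C * stage_growth U2 n z"
      by (auto simp: upper_def)
    have "fst p z \<le> C * stage_growth U1 (Suc n) z" "snd p z \<le> C * stage_growth U2 (Suc n) z" for z
      using C(2,3)[of z] mult_left_mono[OF stage_growth_mono[of n "Suc n" _ z] C(1)]
      by (meson le_SucI order_refl order_trans)+
    then have "upper (Suc n) p" using C(1) by (auto simp: upper_def)
    then show "\<exists>q. (small q \<and> upper (Suc n) q \<and> lower (Suc n) q) \<and> p \<le> q"
      using p nonneg[of n p] by (intro enlarge) simp_all
  qed
  then obtain s where s: "\<And>n. small (s n)" "\<And>n. lower n (s n)" "\<And>n. s n \<le> s (Suc n)"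
    and s_upper: "\<And>n. upper n (s n)" by blast
  show ?thesis
  proof
    show "incseq (\<lambda>n. fst (s n))" "incseq (\<lambda>n. snd (s n))"
      using s(3) by (auto intro!: incseq_SucI simp: less_eq_prod_def)
    show "\<exists>e>0. \<forall>z. e * stage_growth U1 n z \<le> fst (s n) z"
      "\<exists>e>0. \<forall>z. e * stage_growth U2 n z \<le> snd (s n) z" for n
      using s(2)[of n] unfolding lower_def by blast+
    show "\<exists>C\<ge>0. \<forall>z. fst (s n) z \<le> C * stage_growth U1 n z"
      "\<exists>C\<ge>0. \<forall>z. snd (s n) z \<le> C * stage_growth U2 n z" for n
      using s_upper[of n] unfolding upper_def by blast+
    show "norm (u f) < 1" if "entire f" "\<And>z. norm (f z) \<le> fst (s n) z" "\<And>z. norm (f z) \<le> snd (s n) z" for n f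
      using s(1)[of n] that unfolding small_def by blast
  qed
qed

section \<open>Splitting a functional along a union of cones\<close>

text \<open>
  For a sequence \<open>b\<close> from \<open>small_bounds_exist\<close> this is a neighbourhood of \<open>0\<close> in the inductive
  limit. A union of sets given by one pointwise bound each replaces the usual sums of balls.
\<close>

definition bounded_entire :: "(nat \<Rightarrow> complex^'k::finite \<Rightarrow> real) \<Rightarrow> 'k testfun set" where
  "bounded_entire b = {f. entire f \<and> (\<exists>n. \<forall>z. norm (f z) \<le> b n z)}"

lemma bounded_entire_abs_convex:
  assumes b: "incseq b" and fg: "f \<in> bounded_entire b" "g \<in> bounded_entire b"
    and ac: "norm a + norm c \<le> 1"
  shows "(\<lambda>z. a * f z + c * g z) \<in> bounded_entire b"
proof -
  obtain m n where mn: "\<And>z. norm (f z) \<le> b m z" "\<And>z. norm (g z) \<le> b n z"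
    using fg by (auto simp: bounded_entire_def)
  have "norm (a * f z + c * g z) \<le> b (max m n) z" for z
  proof -
    have "b m z \<le> b (max m n) z" "b n z \<le> b (max m n) z"
      using b by (auto simp: incseq_def le_fun_def)
    then have le: "norm (f z) \<le> b (max m n) z" "norm (g z) \<le> b (max m n) z"
      using mn order_trans by blast+
    have "norm (a * f z + c * g z) \<le> norm a * norm (f z) + norm c * norm (g z)"
      using norm_triangle_ineq[of "a * f z" "c * g z"] by (simp add: norm_mult)
    also have "\<dots> \<le> norm a * b (max m n) z + norm c * b (max m n) z"
      using le by (intro add_mono mult_left_mono) auto
    also have "\<dots> = (norm a + norm c) * b (max m n) z" by (simp add: algebra_simps)
    also have "\<dots> \<le> 1 * b (max m n) z"
      using ac order_trans[OF norm_ge_zero le(1)] by (intro mult_right_mono)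
    finally show ?thesis by simp
  qed
  then show ?thesis
    using fg entire_lincomb unfolding bounded_entire_def by blast
qed

lemma scaled_in_bounded_entire:
  assumes f: "entire f" "\<And>z. norm (f z) \<le> N * stage_growth U n z"
    and e: "\<And>z. e * stage_growth U n z \<le> b n z" and c: "0 \<le> c" "c * N \<le> e"
  shows "(\<lambda>z. complex_of_real c * f z) \<in> bounded_entire b"
proof -
  have "norm (complex_of_real c * f z) \<le> b n z" for z
  proof -
    have "norm (complex_of_real c * f z) \<le> c * (N * stage_growth U n z)"
      using f(2) c(1) by (simp add: norm_mult mult_left_mono)
    also have "\<dots> = (c * N) * stage_growth U n z" by simp
    also have "\<dots> \<le> e * stage_growth U n z"
      using c(2) by (intro mult_right_mono) auto
    also have "\<dots> \<le> b n z" by (rule e)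
    finally show ?thesis .
  qed
  moreover have "entire (\<lambda>z. complex_of_real c * f z)"
    using entire_lincomb[OF f(1) f(1), of "complex_of_real c" 0] by simp
  ultimately show ?thesis by (auto simp: bounded_entire_def)
qed

lemma bounded_entire_absorbing:
  assumes U: "pcone U" "closed U" and f: "f \<in> test_space U"
    and low: "\<And>n. \<exists>e>0. \<forall>z. e * stage_growth U n z \<le> b n z"
  shows "\<exists>t0>0. \<forall>t\<ge>t0. (\<lambda>z. complex_of_real (1 / t) * f z) \<in> bounded_entire b"
proof -
  obtain n C where C: "entire f" "C > 0" "\<And>z. norm (f z) \<le> C * stage_growth U n z"
    using f test_space_iff[OF U] by metis
  obtain e where e: "e > 0" "\<And>z. e * stage_growth U n z \<le> b n z" using low by blast
  show ?thesis
  proof (intro exI[of _ "C / e"] conjI allI impI)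
    show "C / e > 0" using C e by simp
    fix t assume t: "C / e \<le> t"
    then have "t > 0" using C e by (meson divide_pos_pos less_le_trans)
    with t show "(\<lambda>z. complex_of_real (1 / t) * f z) \<in> bounded_entire b"
      using C e by (intro scaled_in_bounded_entire[where N = C and U = U and n = n and e = e])
        (auto simp: field_simps)
  qed
qed

lemma bounded_entire_subset_test_space:
  assumes U: "pcone U" "closed U"
    and up: "\<And>n. \<exists>C\<ge>0. \<forall>z. b n z \<le> C * stage_growth U n z"
  shows "bounded_entire b \<subseteq> test_space U"
proof
  fix f assume "f \<in> bounded_entire b"
  then obtain n where n: "entire f" "\<And>z. norm (f z) \<le> b n z" by (auto simp: bounded_entire_def)
  obtain C where C: "C \<ge> 0" "\<And>z. b n z \<le> C * stage_growth U n z" using up by blast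
  have "norm (f z) \<le> (C + 1) * stage_growth U n z" for z
    using n(2)[of z] C(2)[of z] stage_growth_pos(1)[of U n z] unfolding distrib_right by linarith
  moreover have "C + 1 > 0" using C by simp
  ultimately show "f \<in> test_space U" using n(1) test_space_iff[OF U] by blast
qed

lemma zero_in_bounded_entire:
  assumes "f \<in> bounded_entire b"
  shows "0 \<in> bounded_entire b"
proof -
  have "entire 0" unfolding entire_def by (intro allI exI[of _ "\<lambda>z. 0"]) (auto simp: zero_fun_def)
  moreover obtain n where "\<And>z. norm (f z) \<le> b n z" using assms by (auto simp: bounded_entire_def)
  then have "\<And>z. 0 \<le> b n z" using norm_ge_zero order_trans by blast
  ultimately show ?thesis by (auto simp: bounded_entire_def)
qed

text \<open>
  Boundedness on \<open>bounded_entire b\<close> gives boundedness on each step by scaling. The extension by \<open>0\<close>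
  is the normal form of functionals in \<open>dual_space\<close>.
\<close>

lemma dual_space_of_bounded_entire:
  assumes U: "pcone U" "closed U"
    and low: "\<And>n. \<exists>e>0. \<forall>z. e * stage_growth U n z \<le> b n z"
    and add: "\<And>f g. f \<in> test_space U \<Longrightarrow> g \<in> test_space U \<Longrightarrow> H (f + g) = H f + H g"
    and scale: "\<And>c f. f \<in> test_space U \<Longrightarrow> H (\<lambda>z. c * f z) = c * H f"
    and bound: "\<And>f. f \<in> bounded_entire b \<Longrightarrow> norm (H f) \<le> M"
  shows "(\<lambda>f. if f \<in> test_space U then H f else 0) \<in> dual_space U" (is "?L \<in> _")
proof (rule dual_spaceI[OF U])
  show "?L (f + g) = ?L f + ?L g" if "f \<in> test_space U" "g \<in> test_space U" for f g
    using that test_space_add[OF U] add by simp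
  show "?L (\<lambda>z. c * f z) = c * ?L f" if "f \<in> test_space U" for c f
    using that test_space_scale[OF U] scale by simp
  fix n
  obtain e where e: "e > 0" "\<And>z. e * stage_growth U n z \<le> b n z" using low by blast
  have "norm (?L f) \<le> M / e * N"
    if f: "entire f" "N > 0" "\<forall>z. norm (f z) \<le> N * stage_growth U n z" for f N
  proof -
    have "f \<in> test_space U" using f test_space_iff[OF U] by blast
    have "(\<lambda>z. complex_of_real (e / N) * f z) \<in> bounded_entire b"
      using e f by (intro scaled_in_bounded_entire[where N = N and U = U and n = n and e = e]) auto
    then have "e / N * norm (H f) \<le> M"
      using bound scale[OF \<open>f \<in> test_space U\<close>, of "complex_of_real (e / N)"] e(1) f(2)
      by (metis abs_of_pos divide_pos_pos norm_mult norm_of_real)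
    then show ?thesis using e(1) f(2) \<open>f \<in> test_space U\<close> by (simp add: field_simps)
  qed
  then show "\<exists>C. \<forall>f N. entire f \<longrightarrow> N > 0 \<longrightarrow> (\<forall>z. norm (f z) \<le> N * stage_growth U n z) \<longrightarrow>
                norm (?L f) \<le> C * N" by blast
qed auto

text \<open>
  The functional \<open>(f, f) \<mapsto> u f\<close> on the diagonal \<open>F\<close> of the product \<open>E\<close> is bounded by \<open>1\<close> on the
  product \<open>V\<close> of the two neighbourhoods built from \<open>small_bounds_exist\<close>. A Hahn-Banach extension \<open>G\<close>
  to \<open>E\<close> splits as \<open>G (f, g) = G (f, 0) + G (0, g)\<close>, which gives the two summands.
\<close>

proposition dual_space_decompose:
  fixes U1 U2 :: "(real^'k) set"
  assumes U: "pcone U1" "closed U1" "pcone U2" "closed U2"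
    and u: "u \<in> dual_space (U1 \<union> U2)"
  shows "\<exists>u1\<in>dual_space U1. \<exists>u2\<in>dual_space U2. u = restr (U1 \<union> U2) u1 + restr (U1 \<union> U2) u2"
proof -
  obtain b1 b2 :: "nat \<Rightarrow> complex^'k \<Rightarrow> real" where b: "incseq b1" "incseq b2"
    and low1: "\<And>n. \<exists>e>0. \<forall>z. e * stage_growth U1 n z \<le> b1 n z"
    and low2: "\<And>n. \<exists>e>0. \<forall>z. e * stage_growth U2 n z \<le> b2 n z"
    and up1: "\<And>n. \<exists>C\<ge>0. \<forall>z. b1 n z \<le> C * stage_growth U1 n z"
    and up2: "\<And>n. \<exists>C\<ge>0. \<forall>z. b2 n z \<le> C * stage_growth U2 n z"
    and small: "\<And>n f. entire f \<Longrightarrow> (\<And>z. norm (f z) \<le> b1 n z) \<Longrightarrow> (\<And>z. norm (f z) \<le> b2 n z) \<Longrightarrow>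
       norm (u f) < 1"
    by (rule small_bounds_exist[OF U u]) blast
  define scale :: "complex \<Rightarrow> 'k testfun \<times> 'k testfun \<Rightarrow> 'k testfun \<times> 'k testfun"
    where "scale c p = (\<lambda>z. c * fst p z, \<lambda>z. c * snd p z)" for c p
  have vs: "vector_space scale"
    by unfold_locales (auto simp: scale_def fun_eq_iff algebra_simps)
  interpret vs: vector_space scale by (rule vs)
  define E where "E = test_space U1 \<times> test_space U2"
  define F where "F = (\<lambda>f. (f, f)) ` test_space (U1 \<union> U2)"
  define V where "V = bounded_entire b1 \<times> bounded_entire b2"
  have UU: "pcone (U1 \<union> U2)" "closed (U1 \<union> U2)" using U pcone_Un by auto
  have zero_fun: "(\<lambda>z. 0) = (0 :: 'k testfun)" by auto
  have zero: "0 \<in> test_space S" if "pcone S" "closed S" for S :: "(real^'k) set"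
    using test_space_zero[OF that] by (simp add: zero_fun)
  have zero_ball: "0 \<in> bounded_entire b1" "0 \<in> bounded_entire b2"
    using bounded_entire_absorbing[OF U(1,2) zero[OF U(1,2)] low1]
      bounded_entire_absorbing[OF U(3,4) zero[OF U(3,4)] low2] zero_in_bounded_entire by blast+
  have "\<exists>G. (\<forall>x\<in>E. \<forall>y\<in>E. G (x + y) = G x + G y) \<and> (\<forall>x\<in>E. \<forall>c. G (scale c x) = c * G x) \<and>
             (\<forall>x\<in>F. G x = (u \<circ> fst) x) \<and> (\<forall>v\<in>V. norm (G v) \<le> 2)"
  proof (rule complex_hahn_banach[OF vs])
    show "vs.subspace E"
      using zero test_space_add test_space_scale U
      by (auto simp: vs.subspace_def E_def scale_def zero_prod_def)
    show "vs.subspace F"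
      using zero[OF UU] test_space_add[OF UU] test_space_scale[OF UU]
      by (auto simp: vs.subspace_def F_def scale_def zero_prod_def)
    show "F \<subseteq> E"
      using test_space_antimono[of U1 "U1 \<union> U2"] test_space_antimono[of U2 "U1 \<union> U2"]
      by (auto simp: F_def E_def)
    show "(u \<circ> fst) (x + y) = (u \<circ> fst) x + (u \<circ> fst) y" if "x \<in> F" "y \<in> F" for x y
      using that dual_space_add[OF u] by (auto simp: F_def)
    show "(u \<circ> fst) (scale c x) = c * (u \<circ> fst) x" if "x \<in> F" for x c
      using that dual_space_scale[OF u] by (auto simp: F_def scale_def)
    show "V \<subseteq> E"
      using bounded_entire_subset_test_space[OF U(1,2) up1]
        bounded_entire_subset_test_space[OF U(3,4) up2] by (auto simp: V_def E_def)
    show "scale a v + scale c w \<in> V" if "v \<in> V" "w \<in> V" "norm a + norm c \<le> 1" for v w a c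
      using that bounded_entire_abs_convex[OF b(1), of "fst v" "fst w" a c]
        bounded_entire_abs_convex[OF b(2), of "snd v" "snd w" a c]
      by (auto simp: V_def scale_def plus_fun_def)
    show "\<exists>t>0. \<exists>v\<in>V. x = scale (complex_of_real t) v" if "x \<in> E" for x
    proof -
      have "fst x \<in> test_space U1" "snd x \<in> test_space U2" using that by (auto simp: E_def)
      then obtain t1 t2 where t: "t1 > 0" "t2 > 0"
        and in1: "\<And>t. t \<ge> t1 \<Longrightarrow> (\<lambda>z. complex_of_real (1 / t) * fst x z) \<in> bounded_entire b1"
        and in2: "\<And>t. t \<ge> t2 \<Longrightarrow> (\<lambda>z. complex_of_real (1 / t) * snd x z) \<in> bounded_entire b2"
        using bounded_entire_absorbing[OF U(1,2) _ low1] bounded_entire_absorbing[OF U(3,4) _ low2]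
        by metis
      define t where "t = max t1 t2"
      have "t > 0" using t by (simp add: t_def)
      moreover have "scale (complex_of_real (1 / t)) x \<in> V"
        using in1[of t] in2[of t] by (simp add: t_def V_def scale_def)
      moreover have "x = scale (complex_of_real t) (scale (complex_of_real (1 / t)) x)"
        using \<open>t > 0\<close> by (simp add: vs.scale_scale flip: of_real_mult)
      ultimately show ?thesis by blast
    qed
    show "norm ((u \<circ> fst) v) \<le> 1" if "v \<in> V" "v \<in> F" for v
    proof -
      obtain f where f: "v = (f, f)" using \<open>v \<in> F\<close> by (auto simp: F_def)
      then obtain m n where mn: "entire f" "\<And>z. norm (f z) \<le> b1 m z" "\<And>z. norm (f z) \<le> b2 n z"
        using \<open>v \<in> V\<close> by (auto simp: V_def bounded_entire_def)
      have up: "b1 m z \<le> b1 (max m n) z" "b2 n z \<le> b2 (max m n) z" for z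
        using b by (auto simp: incseq_def le_fun_def)
      have "norm (u f) < 1"
        by (rule small[OF mn(1) order_trans[OF mn(2) up(1)] order_trans[OF mn(3) up(2)]])
      then show ?thesis by (simp add: f)
    qed
  qed
  then obtain G where G_add: "\<And>x y. x \<in> E \<Longrightarrow> y \<in> E \<Longrightarrow> G (x + y) = G x + G y"
    and G_scale: "\<And>x c. x \<in> E \<Longrightarrow> G (scale c x) = c * G x"
    and G_F: "\<And>x. x \<in> F \<Longrightarrow> G x = (u \<circ> fst) x"
    and G_V: "\<And>v. v \<in> V \<Longrightarrow> norm (G v) \<le> 2"
    by blast
  have G_u: "G (f, f) = u f" if "f \<in> test_space (U1 \<union> U2)" for f
    using G_F[of "(f, f)"] that by (simp add: F_def)
  note z1 = zero[OF U(1,2)] and z2 = zero[OF U(3,4)]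
  define u1 where "u1 = (\<lambda>f. if f \<in> test_space U1 then G (f, 0) else 0)"
  define u2 where "u2 = (\<lambda>f. if f \<in> test_space U2 then G (0, f) else 0)"
  have "u1 \<in> dual_space U1"
    unfolding u1_def
  proof (rule dual_space_of_bounded_entire[OF U(1,2) low1])
    show "G (f + g, 0) = G (f, 0) + G (g, 0)" if "f \<in> test_space U1" "g \<in> test_space U1" for f g
      using that z2 G_add[of "(f, 0)" "(g, 0)"] by (simp add: E_def)
    show "G (\<lambda>z. c * f z, 0) = c * G (f, 0)" if "f \<in> test_space U1" for c f
      using that z2 G_scale[of "(f, 0)" c] by (simp add: E_def scale_def zero_fun)
    show "norm (G (f, 0)) \<le> 2" if "f \<in> bounded_entire b1" for f
      using that zero_ball by (intro G_V) (simp add: V_def)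
  qed
  moreover have "u2 \<in> dual_space U2"
    unfolding u2_def
  proof (rule dual_space_of_bounded_entire[OF U(3,4) low2])
    show "G (0, f + g) = G (0, f) + G (0, g)" if "f \<in> test_space U2" "g \<in> test_space U2" for f g
      using that z1 G_add[of "(0, f)" "(0, g)"] by (simp add: E_def)
    show "G (0, \<lambda>z. c * f z) = c * G (0, f)" if "f \<in> test_space U2" for c f
      using that z1 G_scale[of "(0, f)" c] by (simp add: E_def scale_def zero_fun)
    show "norm (G (0, f)) \<le> 2" if "f \<in> bounded_entire b2" for f
      using that zero_ball by (intro G_V) (simp add: V_def)
  qed
  moreover have "u = restr (U1 \<union> U2) u1 + restr (U1 \<union> U2) u2"
  proof
    fix f
    show "u f = (restr (U1 \<union> U2) u1 + restr (U1 \<union> U2) u2) f"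
    proof (cases "f \<in> test_space (U1 \<union> U2)")
      case True
      then have "f \<in> test_space U1" "f \<in> test_space U2"
        using test_space_antimono[of U1 "U1 \<union> U2"] test_space_antimono[of U2 "U1 \<union> U2"] by auto
      then show ?thesis
        using True G_u[OF True] G_add[of "(f, 0)" "(0, f)"] z1 z2
        by (simp add: restr_def u1_def u2_def E_def)
    next
      case False
      then show ?thesis using dual_space_outside[OF u] by (simp add: restr_def)
    qed
  qed
  ultimately show ?thesis by blast
qed

section \<open>Splitting ultrafunctionals\<close>

lemma zero_in_dual_space: "0 \<in> dual_space U"
  by (simp add: dual_space_def zero_fun_def)

lemma dual_space_closed_add:
  assumes "u \<in> dual_space U" "v \<in> dual_space U"
  shows "u + v \<in> dual_space U"
proof -
  have "continuous_map (test_topology U) euclidean (\<lambda>f. u f + v f)"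
    using assms by (intro continuous_map_add) (auto simp: dual_space_def)
  then show ?thesis
    using assms by (simp add: dual_space_def plus_fun_def algebra_simps)
qed

lemma summand_add: "summand K (u + v) = summand K u + summand K v"
  by (auto simp: summand_def fun_eq_iff)

lemma summand_in_direct_sum:
  assumes "K \<in> proper_closed_cones M" "u \<in> dual_space K"
  shows "summand K u \<in> direct_sum M"
proof -
  have "finite {L. summand K u L \<noteq> 0}"
    by (rule finite_subset[of _ "{K}"]) (auto simp: summand_def)
  then show ?thesis
    using assms zero_in_dual_space by (auto simp: direct_sum_def summand_def)
qed

lemma direct_sum_add:
  assumes "v \<in> direct_sum M" "w \<in> direct_sum M"
  shows "v + w \<in> direct_sum M"
proof -
  have "finite {K. (v + w) K \<noteq> 0}"
    by (rule finite_subset[of _ "{K. v K \<noteq> 0} \<union> {K. w K \<noteq> 0}"])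
       (use assms in \<open>auto simp: direct_sum_def\<close>)
  then show ?thesis
    using assms by (auto simp: direct_sum_def intro: dual_space_closed_add)
qed

lemma direct_sum_sum:
  "finite S \<Longrightarrow> (\<And>i. i \<in> S \<Longrightarrow> v i \<in> direct_sum M) \<Longrightarrow> (\<Sum>i\<in>S. v i) \<in> direct_sum M"
proof (induction rule: finite_induct)
  case empty
  show ?case using zero_in_dual_space by (auto simp: direct_sum_def)
qed (auto intro: direct_sum_add)

lemma direct_sum_mono:
  assumes "M \<subseteq> N"
  shows "direct_sum M \<subseteq> direct_sum N"
proof -
  have "proper_closed_cones M \<subseteq> proper_closed_cones N"
    using assms by (auto simp: proper_closed_cones_def)
  then show ?thesis
    using zero_in_dual_space unfolding direct_sum_def
    by (smt (verit, del_insts) mem_Collect_eq subsetD subsetI)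
qed

lemma sum_family_apply: "(\<Sum>i\<in>S. v i) L = (\<Sum>i\<in>S. v i L)" for v :: "'i \<Rightarrow> 'k::finite family"
  by (induction S rule: infinite_finite_induct) auto

lemma direct_sum_eq_sum_summand:
  assumes "v \<in> direct_sum M"
  shows "v = (\<Sum>K | v K \<noteq> 0. summand K (v K))"
proof
  fix L
  have "finite {K. v K \<noteq> 0}" using assms by (simp add: direct_sum_def)
  then have "(\<Sum>K | v K \<noteq> 0. if L = K then v K else 0) = v L"
    by (simp add: sum.delta)
  then show "v L = (\<Sum>K | v K \<noteq> 0. summand K (v K)) L"
    by (simp add: sum_family_apply summand_def)
qed

text \<open>
  The intersection is nonempty, since closed cones contain the origin, and properness is inherited
  by smaller cones.
\<close>

lemma proper_closed_cones_Int:
  assumes "K \<in> proper_closed_cones M" "pcone L" "closed L"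
  shows "K \<inter> L \<in> proper_closed_cones L"
proof -
  have K: "pcone K" "closed K" using assms(1) by (auto simp: proper_closed_cones_def proper_cone_def)
  have "closure (K \<inter> L) \<subseteq> closure K" by (rule closure_mono) auto
  then have "proper_cone (K \<inter> L)"
    using assms(1) pcone_Int_closed[OF K assms(2,3)]
    unfolding proper_closed_cones_def proper_cone_def by blast
  then show ?thesis
    using K assms by (auto simp: proper_closed_cones_def)
qed

lemma ultra_coset_eq:
  assumes "v - w \<in> relations M"
  shows "v +o relations M = w +o relations M"
proof -
  have sub: "x + y \<in> relations M" "- x \<in> relations M" if "x \<in> relations M" "y \<in> relations M" for x y
    using that unfolding relations_def by (auto intro: family.span_add family.span_neg)
  have "v + x = w + ((v - w) + x)" "w + x = v + (- (v - w) + x)" for x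
    by (simp_all add: algebra_simps)
  then show ?thesis
    unfolding elt_set_plus_def using sub assms by blast
qed

lemma carried_by_coset:
  assumes "v \<in> direct_sum K"
  shows "v +o relations UNIV \<in> ultra UNIV" "carried_by (v +o relations UNIV) K"
proof -
  show "v +o relations UNIV \<in> ultra UNIV"
    using assms direct_sum_mono[OF subset_UNIV] by (auto simp: ultra_def)
  have "v +o relations UNIV = canonical_map UNIV (v +o relations K)"
    by (rule canonical_map_coset[OF subset_UNIV, symmetric])
  then show "carried_by (v +o relations UNIV) K"
    using assms unfolding carried_by_def ultra_def by blast
qed

text \<open>
  At each cone \<open>K\<close> of the support, the component \<open>v K\<close> is split into restrictions of functionals
  \<open>a K\<close> and \<open>b K\<close> on the test spaces of \<open>K \<inter> K1\<close> and \<open>K \<inter> K2\<close>; moving these two from \<open>K\<close> to the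
  smaller cones changes the family only by generators of the relations.
\<close>

theorem theorem3p8:
  fixes K1 K2 :: "(real^'k) set" and u :: "'k family set"
  assumes "pcone K1" and "closed K1"
    and "pcone K2" and "closed K2"
    and "u \<in> ultra UNIV"
    and "carried_by u (K1 \<union> K2)"
  shows "\<exists>u1\<in>ultra UNIV. \<exists>u2\<in>ultra UNIV.
           carried_by u1 K1 \<and> carried_by u2 K2 \<and> u = u1 + u2"
proof -
  obtain v where v: "v \<in> direct_sum (K1 \<union> K2)" and u: "u = v +o relations UNIV"
    using assms(6) canonical_map_coset[OF subset_UNIV]
    unfolding carried_by_def ultra_def by auto
  define S where "S = {K. v K \<noteq> 0}"
  have S: "finite S" and SP: "\<And>K. K \<in> S \<Longrightarrow> K \<in> proper_closed_cones (K1 \<union> K2)"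
    using v unfolding direct_sum_def S_def by blast+
  have mem1: "K \<inter> K1 \<in> proper_closed_cones K1" and mem2: "K \<inter> K2 \<in> proper_closed_cones K2"
    if "K \<in> S" for K
    using proper_closed_cones_Int[OF SP[OF that]] assms by blast+
  have "\<forall>K\<in>S. \<exists>a b. a \<in> dual_space (K \<inter> K1) \<and> b \<in> dual_space (K \<inter> K2) \<and>
      v K = restr K a + restr K b"
  proof
    fix K assume K: "K \<in> S"
    have union: "(K \<inter> K1) \<union> (K \<inter> K2) = K"
      using SP[OF K] by (auto simp: proper_closed_cones_def)
    moreover have "v K \<in> dual_space K" using v SP[OF K] by (auto simp: direct_sum_def)
    moreover have "pcone (K \<inter> K1)" "closed (K \<inter> K1)" "pcone (K \<inter> K2)" "closed (K \<inter> K2)"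
      using mem1[OF K] mem2[OF K] by (auto simp: proper_closed_cones_def proper_cone_def)
    ultimately show "\<exists>a b. a \<in> dual_space (K \<inter> K1) \<and> b \<in> dual_space (K \<inter> K2) \<and>
        v K = restr K a + restr K b"
      using dual_space_decompose[of "K \<inter> K1" "K \<inter> K2" "v K"] by auto
  qed
  then obtain a b where a: "\<And>K. K \<in> S \<Longrightarrow> a K \<in> dual_space (K \<inter> K1)"
    and b: "\<And>K. K \<in> S \<Longrightarrow> b K \<in> dual_space (K \<inter> K2)"
    and ab: "\<And>K. K \<in> S \<Longrightarrow> v K = restr K (a K) + restr K (b K)"
    by metis
  define v1 where "v1 = (\<Sum>K\<in>S. summand (K \<inter> K1) (a K))"
  define v2 where "v2 = (\<Sum>K\<in>S. summand (K \<inter> K2) (b K))"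
  have v1: "v1 \<in> direct_sum K1"
    unfolding v1_def using S mem1 a by (intro direct_sum_sum summand_in_direct_sum)
  have v2: "v2 \<in> direct_sum K2"
    unfolding v2_def using S mem2 b by (intro direct_sum_sum summand_in_direct_sum)
  have rel: "summand K' w - summand K (restr K w) \<in> relations UNIV"
    if "K' \<in> proper_closed_cones M" "K \<in> proper_closed_cones N" "K' \<subseteq> K" "w \<in> dual_space K'"
    for K' K M N and w :: "'k functional"
    unfolding relations_def
    by (rule family.span_base) (use that in \<open>auto simp: proper_closed_cones_def\<close>)
  have "v1 + v2 - v = (\<Sum>K\<in>S. (summand (K \<inter> K1) (a K) - summand K (restr K (a K)))
      + (summand (K \<inter> K2) (b K) - summand K (restr K (b K))))"
  proof -
    have "v = (\<Sum>K\<in>S. summand K (restr K (a K)) + summand K (restr K (b K)))"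
      using direct_sum_eq_sum_summand[OF v] by (simp add: ab summand_add flip: S_def)
    then show ?thesis
      by (simp add: v1_def v2_def sum.distrib sum_subtractf)
  qed
  also have "\<dots> \<in> relations UNIV"
  proof -
    have "summand (K \<inter> K1) (a K) - summand K (restr K (a K)) \<in> relations UNIV"
      "summand (K \<inter> K2) (b K) - summand K (restr K (b K)) \<in> relations UNIV" if "K \<in> S" for K
      using rel[OF mem1[OF that] SP[OF that] _ a[OF that]] rel[OF mem2[OF that] SP[OF that] _ b[OF that]]
      by auto
    then show ?thesis
      unfolding relations_def by (intro family.span_sum family.span_add)
  qed
  finally have "u = (v1 +o relations UNIV) + (v2 +o relations UNIV)"
    unfolding u ultra_add by (rule ultra_coset_eq[symmetric])
  then show ?thesis
    using carried_by_coset[OF v1] carried_by_coset[OF v2] by blast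
qed

end
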